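(* Let $\mathbf{M}=(M;\cdot,1)$ be a topological monoid. Then the following are equivalent. (1) $\mathbf{M}$ is topologically isomorphic to the endomorphism monoid of a countable structure. (2) $\mathbf{M}$ is topologically isomorphic to a closed submonoid of $\mathbb{N}^{\mathbb{N}}$. (3) $\mathbf{M}$ is separable and admits a compatible complete left non-expansive ultrametric. (4) $\mathbf{M}$ is Hausdorff and has a complete compatible uniformity with a countable base $\mathcal{B}$ such that (a) each element of $\mathcal{B}$ is an equivalence relation on $M$ of countable index, and (b) for all $U\in\mathcal{B}$ and all $x,y,z\in M$, if $(y,z)\in U$ then $(xy,xz)\in U$.
   Context: $\mathbb{N}=\{1,2,\dots\}$. A topological monoid is a monoid with a topology for which multiplication is continuous. For a set $X$, $X^X$ is the monoid of all functions $X\to X$ under composition, with the topology of pointwise convergence (the product topology with $X$ discrete); $\mathbb{N}^{\mathbb{N}}$ is the case $X=\mathbb{N}$. The endomorphism monoid $\operatorname{End}(\Gamma)$ of a structure $\Gamma$ with domain $X$ is a submonoid of $X^X$ and carries the subspace topology. A structure is countable if its domain is countable. A topological isomorphism of topological monoids is a monoid isomorphism that is a homeomorphism. A metric on $M$ is compatible if it induces the topology of $\mathbf{M}$. A metric $d$ on $M$ is left non-expansive if $d(gf,gf')\le d(f,f')$ for all $g,f,f'\in M$. A metric $d$ is an ultrametric if $d(x,z)\le\max(d(x,y),d(y,z))$ for all $x,y,z$. A uniformity $\mathcal{U}$ on $X$ is a nonempty collection of reflexive binary relations on $X$ (entourages), closed under supersets in $X^2$, inverses and finite intersections, and such that each $U\in\mathcal{U}$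 contains $V\circ V$ for some $V\in\mathcal{U}$. A base of $\mathcal{U}$ is a subset $\mathcal{B}\subseteq\mathcal{U}$ such that each $V\in\mathcal{U}$ contains some $W\in\mathcal{B}$. The uniformity $\mathcal{U}$ is compatible with a topology if the open sets are exactly those $O$ such that for every $x\in O$ there is $U\in\mathcal{U}$ with $\{y \mid (x,y)\in U\}\subseteq O$. A filter $\mathcal{F}$ on $X$ is Cauchy if for every $U\in\mathcal{U}$ there is $A\in\mathcal{F}$ with $A\times A\subseteq U$; it converges to $x$ if $\{y\mid (x,y)\in U\}\in\mathcal{F}$ for all $U\in\mathcal{U}$; $\mathcal{U}$ is complete if every Cauchy filter converges. The index of an equivalence relation is the cardinality of its set of classes. *)

theory Defs
  imports
    "HOL-Analysis.Analysis"
    "HOL-Algebra.Group"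
    "HOL-Library.Infinite_Typeclass"
begin

section \<open>Topological monoids\<close>

definition topological_monoid :: "('a, 'm) monoid_scheme \<Rightarrow> 'a topology \<Rightarrow> bool" where
  "topological_monoid G T \<longleftrightarrow>
     monoid G \<and> topspace T = carrier G \<and>
     continuous_map (prod_topology T T) T (\<lambda>(x, y). x \<otimes>\<^bsub>G\<^esub> y)"

text \<open>
  Elements of \<^const>\<open>iso\<close> are multiplicative bijections. Preservation of the unit is not part of
  that definition (it is automatic for bijections between monoids), so it is required explicitly.
\<close>

definition topologically_isomorphic ::
  "('a, 'm) monoid_scheme \<Rightarrow> 'a topology \<Rightarrow> ('b, 'n) monoid_scheme \<Rightarrow> 'b topology \<Rightarrow> bool" where
  "topologically_isomorphic G S H T \<longleftrightarrow>
     (\<exists>h. h \<in> iso G H \<and> h \<one>\<^bsub>G\<^esub> = \<one>\<^bsub>H\<^esub> \<and> homeomorphic_map S T h)"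

text \<open>
  Self-maps of a set \<open>X\<close> are represented by the extensional functions in \<open>X \<rightarrow>\<^sub>E X\<close>. The product
  \<open>g \<otimes> f\<close> is \<open>g\<close> after \<open>f\<close>.
\<close>

definition full_transformation_monoid :: "'x set \<Rightarrow> ('x \<Rightarrow> 'x) monoid" where
  "full_transformation_monoid X =
     \<lparr>carrier = X \<rightarrow>\<^sub>E X, mult = compose X, one = (\<lambda>x\<in>X. x)\<rparr>"

definition pointwise_topology :: "'x set \<Rightarrow> ('x \<Rightarrow> 'x) topology" where
  "pointwise_topology X = product_topology (\<lambda>_. discrete_topology X) X"


section \<open>Structures and their endomorphisms\<close>

text \<open>
  A structure interprets relation symbols (from \<open>rel_symbols\<close>) and function symbols (from
  \<open>fun_symbols\<close>) of finite arity on its universe; constants are function symbols of arity 0.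
  Tuples are lists. There is no restriction on the number of symbols.
\<close>

record ('x, 'r, 'f) fo_structure =
  universe :: "'x set"
  rel_symbols :: "'r set"
  rel_arity :: "'r \<Rightarrow> nat"
  rel_interp :: "'r \<Rightarrow> 'x list set"
  fun_symbols :: "'f set"
  fun_arity :: "'f \<Rightarrow> nat"
  fun_interp :: "'f \<Rightarrow> 'x list \<Rightarrow> 'x"

definition tuples :: "'x set \<Rightarrow> nat \<Rightarrow> 'x list set" where
  "tuples X n = {xs. set xs \<subseteq> X \<and> length xs = n}"

definition is_fo_structure :: "('x, 'r, 'f) fo_structure \<Rightarrow> bool" where
  "is_fo_structure \<Gamma> \<longleftrightarrow>
     (\<forall>R\<in>rel_symbols \<Gamma>. rel_interp \<Gamma> R \<subseteq> tuples (universe \<Gamma>) (rel_arity \<Gamma> R)) \<and>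
     (\<forall>F\<in>fun_symbols \<Gamma>. \<forall>xs\<in>tuples (universe \<Gamma>) (fun_arity \<Gamma> F). fun_interp \<Gamma> F xs \<in> universe \<Gamma>)"

definition endomorphisms :: "('x, 'r, 'f) fo_structure \<Rightarrow> ('x \<Rightarrow> 'x) set" where
  "endomorphisms \<Gamma> =
     {h \<in> universe \<Gamma> \<rightarrow>\<^sub>E universe \<Gamma>.
        (\<forall>R\<in>rel_symbols \<Gamma>. \<forall>xs\<in>rel_interp \<Gamma> R. map h xs \<in> rel_interp \<Gamma> R) \<and>
        (\<forall>F\<in>fun_symbols \<Gamma>. \<forall>xs\<in>tuples (universe \<Gamma>) (fun_arity \<Gamma> F).
           h (fun_interp \<Gamma> F xs) = fun_interp \<Gamma> F (map h xs))}"

definition End_monoid :: "('x, 'r, 'f) fo_structure \<Rightarrow> ('x \<Rightarrow> 'x) monoid" where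
  "End_monoid \<Gamma> = full_transformation_monoid (universe \<Gamma>) \<lparr>carrier := endomorphisms \<Gamma>\<rparr>"

definition End_topology :: "('x, 'r, 'f) fo_structure \<Rightarrow> ('x \<Rightarrow> 'x) topology" where
  "End_topology \<Gamma> = subtopology (pointwise_topology (universe \<Gamma>)) (endomorphisms \<Gamma>)"


section \<open>Metrics\<close>

definition ultrametric_on :: "'a set \<Rightarrow> ('a \<Rightarrow> 'a \<Rightarrow> real) \<Rightarrow> bool" where
  "ultrametric_on X d \<longleftrightarrow>
     Metric_space X d \<and> (\<forall>x\<in>X. \<forall>y\<in>X. \<forall>z\<in>X. d x z \<le> max (d x y) (d y z))"

definition left_non_expansive :: "('a, 'm) monoid_scheme \<Rightarrow> ('a \<Rightarrow> 'a \<Rightarrow> real) \<Rightarrow> bool" where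
  "left_non_expansive G d \<longleftrightarrow>
     (\<forall>g\<in>carrier G. \<forall>f\<in>carrier G. \<forall>f'\<in>carrier G. d (g \<otimes>\<^bsub>G\<^esub> f) (g \<otimes>\<^bsub>G\<^esub> f') \<le> d f f')"


section \<open>Uniformities on a set\<close>

definition uniformity_on_set :: "'a set \<Rightarrow> 'a rel set \<Rightarrow> bool" where
  "uniformity_on_set X \<U> \<longleftrightarrow>
     \<U> \<noteq> {} \<and>
     (\<forall>U\<in>\<U>. U \<subseteq> X \<times> X \<and> refl_on X U) \<and>
     (\<forall>U\<in>\<U>. \<forall>V. U \<subseteq> V \<and> V \<subseteq> X \<times> X \<longrightarrow> V \<in> \<U>) \<and>
     (\<forall>U\<in>\<U>. U\<inverse> \<in> \<U>) \<and>
     (\<forall>U\<in>\<U>. \<forall>V\<in>\<U>. U \<inter> V \<in> \<U>) \<and>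
     (\<forall>U\<in>\<U>. \<exists>V\<in>\<U>. V O V \<subseteq> U)"

definition uniformity_base :: "'a rel set \<Rightarrow> 'a rel set \<Rightarrow> bool" where
  "uniformity_base \<U> \<B> \<longleftrightarrow> \<B> \<subseteq> \<U> \<and> (\<forall>V\<in>\<U>. \<exists>W\<in>\<B>. W \<subseteq> V)"

definition compatible_uniformity :: "'a topology \<Rightarrow> 'a rel set \<Rightarrow> bool" where
  "compatible_uniformity T \<U> \<longleftrightarrow>
     (\<forall>S. openin T S \<longleftrightarrow> S \<subseteq> topspace T \<and> (\<forall>x\<in>S. \<exists>U\<in>\<U>. {y. (x, y) \<in> U} \<subseteq> S))"

text \<open>
  A filter on the set \<open>X\<close> is an element \<open>\<F>\<close> of the library type of filters with
  \<open>\<F> \<le> principal X\<close>. The library type includes the improper filter \<open>bot\<close>, which is excluded.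
\<close>

definition complete_uniformity :: "'a set \<Rightarrow> 'a rel set \<Rightarrow> bool" where
  "complete_uniformity X \<U> \<longleftrightarrow>
     (\<forall>\<F>. \<F> \<noteq> bot \<and> \<F> \<le> principal X \<and>
          (\<forall>U\<in>\<U>. \<exists>A. (\<forall>\<^sub>F x in \<F>. x \<in> A) \<and> A \<times> A \<subseteq> U) \<longrightarrow>
          (\<exists>x\<in>X. \<forall>U\<in>\<U>. \<forall>\<^sub>F y in \<F>. (x, y) \<in> U))"


section \<open>Equivalence of several statements\<close>

definition all_equivalent :: "bool list \<Rightarrow> bool" where
  "all_equivalent Ps \<longleftrightarrow> (\<forall>P\<in>set Ps. \<forall>Q\<in>set Ps. P \<longleftrightarrow> Q)"

text \<open>
  HOL cannot quantify over all types inside a formula. A statement about the existence of a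
  countable structure is therefore made for an arbitrary infinite type of elements, an arbitrary
  infinite type of relation symbols and an arbitrary type of function symbols; a countable universe
  is any countable subset (finite or infinite) of the type of elements. With these type variables
  universally quantified at the theorem level, every countable structure in every signature is
  covered. Infinity of the first two types only ensures that they can supply countably many elements
  and relation symbols; it is expressed by the class \<^class>\<open>infinite\<close>.
\<close>

end

theory Submission
  imports Defs
begin

text \<open>
  All four conditions say that the monoid acts faithfully on a countable set \<open>X\<close> so that
  its topology is the one of pointwise convergence and its image in the self-maps of \<open>X\<close> is
  closed. The locale \<open>closed_representation\<close> records this; since a bijection \<open>X
  \<rightarrow> Y\<close> conjugates such an action on \<open>X\<close> into one on \<open>Y\<close>,
  only the size of \<open>X\<close> matters. The implications form a cycle from structures through
  ultrametrics, uniformities and closed submonoids back to structures.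

  From a structure to an ultrametric: preserving a relation or an operation constrains a map on finitely
  many points at a time, so endomorphisms form a closed set. Enumerate the universe and let the distance
  of two maps be \<open>1 / (n + 1)\<close>, where \<open>n\<close> is the index of the first point at
  which they differ. Composing on the left cannot separate two maps at a point where they agree, so this
  ultrametric is left non-expansive; closedness of the image gives completeness.

  From an ultrametric to a uniformity: in an ultrametric, being at distance less than \<open>1 / (n +
  1)\<close> is an equivalence relation. Its classes are open, so separability makes them countable in
  number, and left non-expansiveness is left invariance of the relation.

  From a uniformity to a closed submonoid: left invariance makes left multiplication act on the quotient
  of the monoid by each relation \<open>U\<close> of the base, hence on the disjoint union of these
  countably many countable quotients. The action on the class of \<open>1\<close> modulo
  \<open>U\<close> determines an element modulo \<open>U\<close>, and the action on any other class
  depends continuously on the element because right multiplications are continuous; so the topology is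
  the pointwise one, and faithfulness follows from the Hausdorff property. If a map \<open>f\<close>
  agrees with elements of the monoid on all finite sets, the elements that agree with \<open>f\<close>
  on the class of \<open>1\<close> modulo \<open>U\<close>, as \<open>U\<close> varies, generate a
  Cauchy filter, and its limit acts as \<open>f\<close> everywhere, again because right multiplications
  are continuous.

  From a closed submonoid to a structure: transport the representation to a countably infinite set of
  elements and, for each \<open>n\<close>, take as a relation the orbit of the tuple of the first
  \<open>n\<close> elements. A map preserving these relations agrees on every finite set with an element
  of the monoid, so it belongs to the monoid by closedness.
\<close>

section \<open>Pointwise topology and closed representations\<close>

lemma openin_pointwise_topology:
  "openin (pointwise_topology X) W \<longleftrightarrow>
     W \<subseteq> X \<rightarrow>\<^sub>E X \<and>
     (\<forall>f\<in>W. \<exists>F. finite F \<and> F \<subseteq> X \<and> (\<forall>g\<in>X \<rightarrow>\<^sub>E X. (\<forall>p\<in>F. g p = f p) \<longrightarrow> g \<in> W))"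
  (is "_ \<longleftrightarrow> ?R")
proof
  assume W: "openin (pointwise_topology X) W"
  then have sub: "W \<subseteq> X \<rightarrow>\<^sub>E X"
    using openin_subset[OF W] by (simp add: pointwise_topology_def)
  have "\<exists>F. finite F \<and> F \<subseteq> X \<and> (\<forall>g\<in>X \<rightarrow>\<^sub>E X. (\<forall>p\<in>F. g p = f p) \<longrightarrow> g \<in> W)" if f: "f \<in> W" for f
  proof -
    obtain U where U: "finite {i \<in> X. U i \<noteq> X}" "f \<in> Pi\<^sub>E X U" "Pi\<^sub>E X U \<subseteq> W"
      using W f unfolding pointwise_topology_def openin_product_topology_alt by force
    have "g \<in> W" if g: "g \<in> X \<rightarrow>\<^sub>E X" "\<forall>p\<in>{i \<in> X. U i \<noteq> X}. g p = f p" for g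
    proof -
      have "g i \<in> U i" if "i \<in> X" for i
        using g U(2) that by (cases "U i = X") (auto simp: PiE_iff)
      then have "g \<in> Pi\<^sub>E X U" using g(1) by (auto simp: PiE_iff)
      then show ?thesis using U(3) by blast
    qed
    then show ?thesis using U(1) by (intro exI[of _ "{i \<in> X. U i \<noteq> X}"]) auto
  qed
  with sub show ?R by (intro conjI ballI) simp_all
next
  assume R: ?R
  have "\<exists>U. finite {i \<in> X. U i \<noteq> X} \<and> (\<forall>i\<in>X. U i \<subseteq> X) \<and> f \<in> Pi\<^sub>E X U \<and> Pi\<^sub>E X U \<subseteq> W"
    if f: "f \<in> W" for f
  proof -
    obtain F where F: "finite F" "F \<subseteq> X" "\<And>g. g \<in> X \<rightarrow>\<^sub>E X \<Longrightarrow> (\<forall>p\<in>F. g p = f p) \<Longrightarrow> g \<in> W"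
      using R f by meson
    define U where "U i = (if i \<in> F then {f i} else X)" for i
    have fX: "f \<in> X \<rightarrow>\<^sub>E X" using R f by blast
    have "finite {i \<in> X. U i \<noteq> X}"
      by (rule finite_subset[OF _ F(1)]) (auto simp: U_def)
    moreover have UX: "\<forall>i\<in>X. U i \<subseteq> X" using fX by (auto simp: U_def)
    moreover have "f \<in> Pi\<^sub>E X U" using fX by (auto simp: U_def PiE_iff)
    moreover have "Pi\<^sub>E X U \<subseteq> W"
    proof
      fix g assume g: "g \<in> Pi\<^sub>E X U"
      have "g \<in> X \<rightarrow>\<^sub>E X" using g UX by (auto simp: PiE_iff)
      moreover have "g p = f p" if "p \<in> F" for p
        using g that F(2) by (auto simp: PiE_iff U_def split: if_splits)
      ultimately show "g \<in> W" using F(3) by blast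
    qed
    ultimately show ?thesis by blast
  qed
  then show "openin (pointwise_topology X) W"
    unfolding pointwise_topology_def openin_product_topology_alt by simp
qed

text \<open>
  On a subset of the self-maps, basic neighbourhoods need only be tested against members of the subset.
  For the converse, \<open>W\<close> is enlarged to an open set of arbitrary self-maps by adding all
  maps that agree with some \<open>f \<in> W\<close> on a finite set that witnesses openness of
  \<open>W\<close> at \<open>f\<close>.
\<close>

lemma openin_subtopology_pointwise:
  assumes S: "S \<subseteq> X \<rightarrow>\<^sub>E X"
  shows "openin (subtopology (pointwise_topology X) S) W \<longleftrightarrow>
     W \<subseteq> S \<and> (\<forall>f\<in>W. \<exists>F. finite F \<and> F \<subseteq> X \<and> (\<forall>g\<in>S. (\<forall>p\<in>F. g p = f p) \<longrightarrow> g \<in> W))"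
  (is "_ \<longleftrightarrow> ?R")
proof
  assume "openin (subtopology (pointwise_topology X) S) W"
  then obtain V where V: "openin (pointwise_topology X) V" "W = V \<inter> S"
    unfolding openin_subtopology by blast
  show ?R
  proof (intro conjI ballI)
    show "W \<subseteq> S" using V(2) by blast
    fix f assume "f \<in> W"
    then obtain F where "finite F" "F \<subseteq> X" "\<forall>g\<in>X \<rightarrow>\<^sub>E X. (\<forall>p\<in>F. g p = f p) \<longrightarrow> g \<in> V"
      using V unfolding openin_pointwise_topology by (metis IntD1)
    then show "\<exists>F. finite F \<and> F \<subseteq> X \<and> (\<forall>g\<in>S. (\<forall>p\<in>F. g p = f p) \<longrightarrow> g \<in> W)"
      using V(2) S by (metis IntI subsetD)
  qed
next
  assume R: ?R
  define V where "V = {g \<in> X \<rightarrow>\<^sub>E X. \<exists>f\<in>W. \<exists>F. finite F \<and> F \<subseteq> X \<and>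
    (\<forall>h\<in>S. (\<forall>p\<in>F. h p = f p) \<longrightarrow> h \<in> W) \<and> (\<forall>p\<in>F. g p = f p)}"
  have "openin (pointwise_topology X) V"
    unfolding openin_pointwise_topology
  proof (intro conjI ballI)
    show "V \<subseteq> X \<rightarrow>\<^sub>E X" by (auto simp: V_def)
    fix g assume "g \<in> V"
    then obtain f F where f: "f \<in> W" "finite F" "F \<subseteq> X"
      "\<forall>h\<in>S. (\<forall>p\<in>F. h p = f p) \<longrightarrow> h \<in> W" "\<forall>p\<in>F. g p = f p" unfolding V_def by blast
    then have "g' \<in> V" if "g' \<in> X \<rightarrow>\<^sub>E X" "\<forall>p\<in>F. g' p = g p" for g'
      using that unfolding V_def by (intro CollectI conjI bexI[of _ f] exI[of _ F]) auto
    with f(2,3) show "\<exists>F. finite F \<and> F \<subseteq> X \<and> (\<forall>h\<in>X \<rightarrow>\<^sub>E X. (\<forall>p\<in>F. h p = g p) \<longrightarrow> h \<in> V)"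
      by (intro exI[of _ F]) simp
  qed
  moreover have "W = V \<inter> S"
  proof
    show "W \<subseteq> V \<inter> S"
    proof
      fix f assume f: "f \<in> W"
      then obtain F where "finite F" "F \<subseteq> X" "\<forall>g\<in>S. (\<forall>p\<in>F. g p = f p) \<longrightarrow> g \<in> W"
        using R by blast
      then have "f \<in> V" using f R S unfolding V_def by (intro CollectI conjI bexI[of _ f] exI[of _ F]) auto
      then show "f \<in> V \<inter> S" using f R by blast
    qed
    show "V \<inter> S \<subseteq> W" unfolding V_def by blast
  qed
  ultimately show "openin (subtopology (pointwise_topology X) S) W"
    unfolding openin_subtopology by blast
qed

lemma closedin_pointwise_topology:
  "closedin (pointwise_topology X) S \<longleftrightarrow>
     S \<subseteq> X \<rightarrow>\<^sub>E X \<and>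
     (\<forall>f\<in>X \<rightarrow>\<^sub>E X. (\<forall>F. finite F \<and> F \<subseteq> X \<longrightarrow> (\<exists>g\<in>S. \<forall>p\<in>F. g p = f p)) \<longrightarrow> f \<in> S)"
proof -
  have top: "topspace (pointwise_topology X) = X \<rightarrow>\<^sub>E X"
    by (simp add: pointwise_topology_def)
  have lim: "(\<forall>F. finite F \<and> F \<subseteq> X \<longrightarrow> (\<exists>g\<in>S. \<forall>p\<in>F. g p = f p)) \<longleftrightarrow>
    \<not> (\<exists>F. finite F \<and> F \<subseteq> X \<and> (\<forall>g\<in>X \<rightarrow>\<^sub>E X. (\<forall>p\<in>F. g p = f p) \<longrightarrow> g \<in> (X \<rightarrow>\<^sub>E X) - S))"
    if S: "S \<subseteq> X \<rightarrow>\<^sub>E X" for f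
  proof -
    have "(\<exists>g\<in>S. \<forall>p\<in>F. g p = f p) \<longleftrightarrow>
      \<not> (\<forall>g\<in>X \<rightarrow>\<^sub>E X. (\<forall>p\<in>F. g p = f p) \<longrightarrow> g \<in> (X \<rightarrow>\<^sub>E X) - S)" for F
      using S by blast
    then show ?thesis by meson
  qed
  show ?thesis
  proof (cases "S \<subseteq> X \<rightarrow>\<^sub>E X")
    case True
    have "closedin (pointwise_topology X) S \<longleftrightarrow>
      (\<forall>f\<in>(X \<rightarrow>\<^sub>E X) - S. \<exists>F. finite F \<and> F \<subseteq> X \<and>
        (\<forall>g\<in>X \<rightarrow>\<^sub>E X. (\<forall>p\<in>F. g p = f p) \<longrightarrow> g \<in> (X \<rightarrow>\<^sub>E X) - S))" (is "_ \<longleftrightarrow> (\<forall>f\<in>_. ?Q f)")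
      unfolding closedin_def openin_pointwise_topology top using True
      by (simp only: simp_thms Diff_subset)
    also have "\<dots> \<longleftrightarrow> (\<forall>f\<in>X \<rightarrow>\<^sub>E X. \<not> ?Q f \<longrightarrow> f \<in> S)"
    proof -
      have "(\<forall>f\<in>A - S. Q f) \<longleftrightarrow> (\<forall>f\<in>A. \<not> Q f \<longrightarrow> f \<in> S)" for A and Q :: "('a \<Rightarrow> 'a) \<Rightarrow> bool"
        by blast
      then show ?thesis .
    qed
    finally show ?thesis
      by (simp only: lim[OF True] True simp_thms)
  next
    case False
    then show ?thesis unfolding closedin_def top by simp
  qed
qed

text \<open>
  A closed representation is a topological isomorphism onto a closed submonoid of the self-maps of
  \<open>X\<close>, expressed without topologies on function spaces: \<open>openin_iff_agree\<close>
  says that \<open>T\<close> is the topology of pointwise convergence, and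
  \<open>limit_represented\<close> that the image is closed. In this form it transfers between sets and
  can be verified for concrete actions.
\<close>

locale closed_representation = monoid M
  for M :: "('a, 'm) monoid_scheme" (structure) and T :: "'a topology"
    and X :: "'x set" and \<rho> :: "'a \<Rightarrow> 'x \<Rightarrow> 'x" +
  assumes rep_closed: "x \<in> carrier M \<Longrightarrow> \<rho> x \<in> X \<rightarrow>\<^sub>E X"
    and rep_mult: "\<lbrakk>x \<in> carrier M; y \<in> carrier M; p \<in> X\<rbrakk> \<Longrightarrow> \<rho> (x \<otimes> y) p = \<rho> x (\<rho> y p)"
    and rep_one: "p \<in> X \<Longrightarrow> \<rho> \<one> p = p"
    and rep_inj: "inj_on \<rho> (carrier M)"
    and openin_iff_agree: "openin T W \<longleftrightarrow> W \<subseteq> carrier M \<and>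
      (\<forall>x\<in>W. \<exists>F. finite F \<and> F \<subseteq> X \<and> (\<forall>y\<in>carrier M. (\<forall>p\<in>F. \<rho> y p = \<rho> x p) \<longrightarrow> y \<in> W))"
    and limit_represented: "\<lbrakk>f \<in> X \<rightarrow>\<^sub>E X;
      \<And>F. \<lbrakk>finite F; F \<subseteq> X\<rbrakk> \<Longrightarrow> \<exists>x\<in>carrier M. \<forall>p\<in>F. \<rho> x p = f p\<rbrakk> \<Longrightarrow> f \<in> \<rho> ` carrier M"
begin

lemma topspace_eq: "topspace T = carrier M"
proof -
  have "openin T (carrier M)" unfolding openin_iff_agree by blast
  moreover have "W \<subseteq> carrier M" if "openin T W" for W using that openin_iff_agree by blast
  ultimately show ?thesis by (metis openin_subset openin_topspace subset_antisym)
qed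

lemma rep_in: "\<lbrakk>x \<in> carrier M; p \<in> X\<rbrakk> \<Longrightarrow> \<rho> x p \<in> X"
  using rep_closed by blast

lemma rep_eqI:
  assumes "x \<in> carrier M" "y \<in> carrier M" "\<And>p. p \<in> X \<Longrightarrow> \<rho> x p = \<rho> y p"
  shows "x = y"
proof -
  have "\<rho> x = \<rho> y" using assms rep_closed by (intro PiE_ext[of _ X "\<lambda>_. X"]) auto
  then show ?thesis using rep_inj assms by (auto dest: inj_onD)
qed

lemma rep_mult_compose:
  assumes "x \<in> carrier M" "y \<in> carrier M"
  shows "\<rho> (x \<otimes> y) = compose X (\<rho> x) (\<rho> y)"
proof (rule PiE_ext[of _ X "\<lambda>_. X"])
  show "\<rho> (x \<otimes> y) \<in> X \<rightarrow>\<^sub>E X" using assms rep_closed by simp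
  show "compose X (\<rho> x) (\<rho> y) \<in> X \<rightarrow>\<^sub>E X" using assms rep_in by (simp add: compose_def)
qed (simp add: assms rep_mult compose_def)

lemma rep_one_restrict: "\<rho> \<one> = (\<lambda>p\<in>X. p)"
  by (rule PiE_ext[of _ X "\<lambda>_. X"]) (use rep_closed rep_one in auto)

lemma submonoid_image: "submonoid (\<rho> ` carrier M) (full_transformation_monoid X)"
proof
  show "\<rho> ` carrier M \<subseteq> carrier (full_transformation_monoid X)"
    using rep_closed by (auto simp: full_transformation_monoid_def)
next
  fix f g assume "f \<in> \<rho> ` carrier M" "g \<in> \<rho> ` carrier M"
  then obtain x y where xy: "x \<in> carrier M" "y \<in> carrier M" "f = \<rho> x" "g = \<rho> y" by blast
  then have "compose X f g = \<rho> (x \<otimes> y)" by (simp add: rep_mult_compose)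
  then show "f \<otimes>\<^bsub>full_transformation_monoid X\<^esub> g \<in> \<rho> ` carrier M"
    using xy by (auto simp: full_transformation_monoid_def)
next
  show "\<one>\<^bsub>full_transformation_monoid X\<^esub> \<in> \<rho> ` carrier M"
    by (auto simp: full_transformation_monoid_def rep_one_restrict[symmetric])
qed

lemma closedin_image: "closedin (pointwise_topology X) (\<rho> ` carrier M)"
  unfolding closedin_pointwise_topology
proof (intro conjI ballI impI)
  show "\<rho> ` carrier M \<subseteq> X \<rightarrow>\<^sub>E X" using rep_closed by blast
next
  fix f assume "f \<in> X \<rightarrow>\<^sub>E X" "\<forall>F. finite F \<and> F \<subseteq> X \<longrightarrow> (\<exists>g\<in>\<rho> ` carrier M. \<forall>p\<in>F. g p = f p)"
  then show "f \<in> \<rho> ` carrier M" by (intro limit_represented) auto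
qed

lemma topologically_isomorphic_image:
  "topologically_isomorphic M T (full_transformation_monoid X \<lparr>carrier := \<rho> ` carrier M\<rparr>)
     (subtopology (pointwise_topology X) (\<rho> ` carrier M))"
proof -
  have sub: "\<rho> ` carrier M \<subseteq> X \<rightarrow>\<^sub>E X" using rep_closed by blast
  have iso: "\<rho> \<in> iso M (full_transformation_monoid X \<lparr>carrier := \<rho> ` carrier M\<rparr>)"
    using rep_mult_compose rep_inj
    by (simp add: iso_def hom_def full_transformation_monoid_def bij_betw_def)
  have op: "openin (subtopology (pointwise_topology X) (\<rho> ` carrier M)) (\<rho> ` W) \<longleftrightarrow> openin T W"
    if "W \<subseteq> carrier M" for W
    unfolding openin_subtopology_pointwise[OF sub] openin_iff_agree
    using that rep_inj by (simp add: inj_on_image_mem_iff image_mono)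
  have "homeomorphic_map T (subtopology (pointwise_topology X) (\<rho> ` carrier M)) \<rho>"
  proof (rule bijective_open_imp_homeomorphic_map)
    have ts: "topspace (subtopology (pointwise_topology X) (\<rho> ` carrier M)) = \<rho> ` carrier M"
      using sub by (simp add: pointwise_topology_def topspace_subtopology Int_absorb1)
    show "\<rho> ` topspace T = topspace (subtopology (pointwise_topology X) (\<rho> ` carrier M))"
      by (simp only: ts topspace_eq)
    show "inj_on \<rho> (topspace T)" using rep_inj by (simp add: topspace_eq)
    show "open_map T (subtopology (pointwise_topology X) (\<rho> ` carrier M)) \<rho>"
      unfolding open_map_def using op openin_subset topspace_eq by metis
    show "continuous_map T (subtopology (pointwise_topology X) (\<rho> ` carrier M)) \<rho>"
      unfolding continuous_map
    proof (intro conjI allI impI)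
      show "\<rho> ` topspace T \<subseteq> topspace (subtopology (pointwise_topology X) (\<rho> ` carrier M))"
        by (simp only: ts topspace_eq)
      fix V assume V: "openin (subtopology (pointwise_topology X) (\<rho> ` carrier M)) V"
      have "V = \<rho> ` {x \<in> carrier M. \<rho> x \<in> V}" using openin_subset[OF V] ts by auto
      then show "openin T {x \<in> topspace T. \<rho> x \<in> V}"
        using op[of "{x \<in> carrier M. \<rho> x \<in> V}"] V by (simp add: topspace_eq)
    qed
  qed
  with iso rep_one_restrict show ?thesis
    unfolding topologically_isomorphic_def by (auto simp: full_transformation_monoid_def)
qed

end

lemma closed_representation_of_isomorphic:
  assumes "monoid M" and T: "topspace T = carrier M"
    and S: "closedin (pointwise_topology X) S"
    and iso: "topologically_isomorphic M T (full_transformation_monoid X \<lparr>carrier := S\<rparr>)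
      (subtopology (pointwise_topology X) S)"
  shows "\<exists>\<rho>. closed_representation M T X \<rho>"
proof -
  interpret monoid M by fact
  have sub: "S \<subseteq> X \<rightarrow>\<^sub>E X" using S closedin_pointwise_topology by blast
  obtain h where h: "h \<in> iso M (full_transformation_monoid X \<lparr>carrier := S\<rparr>)"
    "h \<one>\<^bsub>M\<^esub> = (\<lambda>x\<in>X. x)" "homeomorphic_map T (subtopology (pointwise_topology X) S) h"
    using iso unfolding topologically_isomorphic_def by (auto simp: full_transformation_monoid_def)
  have im: "h ` carrier M = S" and inj: "inj_on h (carrier M)"
    and mult: "\<And>x y. \<lbrakk>x \<in> carrier M; y \<in> carrier M\<rbrakk> \<Longrightarrow> h (x \<otimes>\<^bsub>M\<^esub> y) = compose X (h x) (h y)"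
    using h(1) by (auto simp: iso_def hom_def bij_betw_def full_transformation_monoid_def)
  have "closed_representation M T X h"
  proof
    show "h x \<in> X \<rightarrow>\<^sub>E X" if "x \<in> carrier M" for x using that im sub by blast
    show "h (x \<otimes>\<^bsub>M\<^esub> y) p = h x (h y p)" if "x \<in> carrier M" "y \<in> carrier M" "p \<in> X" for x y p
      using that mult by (simp add: compose_def)
    show "h \<one>\<^bsub>M\<^esub> p = p" if "p \<in> X" for p using that h(2) by simp
    show "inj_on h (carrier M)" by (fact inj)
    show "f \<in> h ` carrier M" if f: "f \<in> X \<rightarrow>\<^sub>E X"
      and ap: "\<And>F. \<lbrakk>finite F; F \<subseteq> X\<rbrakk> \<Longrightarrow> \<exists>x\<in>carrier M. \<forall>p\<in>F. h x p = f p" for f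
    proof -
      have "\<forall>F. finite F \<and> F \<subseteq> X \<longrightarrow> (\<exists>g\<in>S. \<forall>p\<in>F. g p = f p)" using ap im by blast
      then show ?thesis using S f unfolding closedin_pointwise_topology im by blast
    qed
    show "openin T W \<longleftrightarrow> W \<subseteq> carrier M \<and>
      (\<forall>x\<in>W. \<exists>F. finite F \<and> F \<subseteq> X \<and> (\<forall>y\<in>carrier M. (\<forall>p\<in>F. h y p = h x p) \<longrightarrow> y \<in> W))" for W
    proof (cases "W \<subseteq> carrier M")
      case True
      then have "openin T W \<longleftrightarrow> openin (subtopology (pointwise_topology X) S) (h ` W)"
        using homeomorphic_map_openness[OF h(3)] T by simp
      also have "\<dots> \<longleftrightarrow> (\<forall>x\<in>W. \<exists>F. finite F \<and> F \<subseteq> X \<and> (\<forall>y\<in>carrier M. (\<forall>p\<in>F. h y p = h x p) \<longrightarrow> y \<in> W))"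
        unfolding openin_subtopology_pointwise[OF sub] using True inj
        by (simp add: im[symmetric] inj_on_image_mem_iff image_mono)
      finally show ?thesis using True by blast
    next
      case False
      then have "\<not> openin T W" using openin_subset T by metis
      with False show ?thesis by simp
    qed
  qed
  then show ?thesis by (intro exI[of _ h])
qed

text \<open>
  Conjugation by a bijection carries agreement on \<open>F\<close> to agreement on the image of
  \<open>F\<close>, so it preserves both the pointwise topology and closedness of the image. This is
  what allows the underlying countably infinite set to be chosen freely.
\<close>

lemma (in closed_representation) closed_representation_conjugate:
  assumes b: "bij_betw b X Y"
  shows "closed_representation M T Y (\<lambda>x. \<lambda>q\<in>Y. b (\<rho> x (inv_into X b q)))"
    (is "closed_representation M T Y ?\<sigma>")
proof
  note inv = bij_betwE[OF bij_betw_inv_into[OF b], rule_format] bij_betw_inv_into_right[OF b]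
  note bY = bij_betwE[OF b, rule_format] bij_betw_inv_into_left[OF b]
  note b_inj = inj_on_eq_iff[OF bij_betw_imp_inj_on[OF b]]
  have agree: "?\<sigma> x q = ?\<sigma> y q \<longleftrightarrow> \<rho> x (inv_into X b q) = \<rho> y (inv_into X b q)"
    if "x \<in> carrier M" "y \<in> carrier M" "q \<in> Y" for x y q
    using that by (simp add: b_inj inv rep_in)
  show "?\<sigma> x \<in> Y \<rightarrow>\<^sub>E Y" if "x \<in> carrier M" for x
    using that by (auto simp: inv bY rep_in)
  show "?\<sigma> (x \<otimes> y) p = ?\<sigma> x (?\<sigma> y p)" if "x \<in> carrier M" "y \<in> carrier M" "p \<in> Y" for x y p
    using that by (simp add: inv bY rep_in rep_mult)
  show "?\<sigma> \<one> p = p" if "p \<in> Y" for p using that by (simp add: inv rep_one)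
  show "inj_on ?\<sigma> (carrier M)"
  proof (rule inj_onI)
    fix x y assume xy: "x \<in> carrier M" "y \<in> carrier M" and eq: "?\<sigma> x = ?\<sigma> y"
    have "\<rho> x p = \<rho> y p" if "p \<in> X" for p
      using agree[OF xy bY(1)[OF that]] fun_cong[OF eq, of "b p"] bY(2)[OF that] by metis
    with xy show "x = y" by (rule rep_eqI)
  qed
  show "openin T W \<longleftrightarrow> W \<subseteq> carrier M \<and>
    (\<forall>x\<in>W. \<exists>F. finite F \<and> F \<subseteq> Y \<and> (\<forall>y\<in>carrier M. (\<forall>p\<in>F. ?\<sigma> y p = ?\<sigma> x p) \<longrightarrow> y \<in> W))" for W
  proof -
    have "(\<exists>F. finite F \<and> F \<subseteq> X \<and> (\<forall>y\<in>carrier M. (\<forall>p\<in>F. \<rho> y p = \<rho> x p) \<longrightarrow> y \<in> W)) \<longleftrightarrow>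
      (\<exists>F. finite F \<and> F \<subseteq> Y \<and> (\<forall>y\<in>carrier M. (\<forall>p\<in>F. ?\<sigma> y p = ?\<sigma> x p) \<longrightarrow> y \<in> W))"
      (is "?L \<longleftrightarrow> ?R") if x: "x \<in> carrier M" for x
    proof
      assume ?L
      then obtain F where F0: "finite F \<and> F \<subseteq> X \<and> (\<forall>y\<in>carrier M. (\<forall>p\<in>F. \<rho> y p = \<rho> x p) \<longrightarrow> y \<in> W)" ..
      note F = F0[THEN conjunct1] F0[THEN conjunct2, THEN conjunct1] F0[THEN conjunct2, THEN conjunct2]
      have "y \<in> W" if y: "y \<in> carrier M" "\<forall>q\<in>b ` F. ?\<sigma> y q = ?\<sigma> x q" for y
      proof (rule F(3)[THEN bspec, OF y(1), THEN mp], rule ballI)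
        fix p assume p: "p \<in> F"
        then have "?\<sigma> y (b p) = ?\<sigma> x (b p)" using y(2) by blast
        then show "\<rho> y p = \<rho> x p"
          using agree[OF y(1) x, of "b p"] p F(2) bY by auto
      qed
      moreover have "finite (b ` F)" "b ` F \<subseteq> Y" using F(1,2) bY(1) by auto
      ultimately show ?R by blast
    next
      assume ?R
      then obtain F where F0: "finite F \<and> F \<subseteq> Y \<and> (\<forall>y\<in>carrier M. (\<forall>p\<in>F. ?\<sigma> y p = ?\<sigma> x p) \<longrightarrow> y \<in> W)" ..
      note F = F0[THEN conjunct1] F0[THEN conjunct2, THEN conjunct1] F0[THEN conjunct2, THEN conjunct2]
      have "y \<in> W" if y: "y \<in> carrier M" "\<forall>q\<in>inv_into X b ` F. \<rho> y q = \<rho> x q" for y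
        by (rule F(3)[THEN bspec, OF y(1), THEN mp]) (use y(2) in auto)
      moreover have "finite (inv_into X b ` F)" "inv_into X b ` F \<subseteq> X" using F(1,2) inv(1) by auto
      ultimately show ?L by blast
    qed
    note eq = this
    show ?thesis
      unfolding openin_iff_agree[of W]
      by (rule conj_cong[OF refl], rule ball_cong[OF refl], rule eq, erule (1) subsetD)
  qed
  show "f \<in> ?\<sigma> ` carrier M" if f: "f \<in> Y \<rightarrow>\<^sub>E Y"
    and ap: "\<And>F. \<lbrakk>finite F; F \<subseteq> Y\<rbrakk> \<Longrightarrow> \<exists>x\<in>carrier M. \<forall>p\<in>F. ?\<sigma> x p = f p" for f
  proof -
    define g where "g = (\<lambda>p\<in>X. inv_into X b (f (b p)))"
    have fY: "f q \<in> Y" if "q \<in> Y" for q using f that by blast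
    have "g \<in> \<rho> ` carrier M"
    proof (rule limit_represented)
      show "g \<in> X \<rightarrow>\<^sub>E X" by (auto simp: g_def inv bY fY)
      fix F assume F: "finite F" "F \<subseteq> X"
      then obtain x where x: "x \<in> carrier M" "\<forall>q\<in>b ` F. ?\<sigma> x q = f q"
        using ap[of "b ` F"] bY(1) by blast
      have "\<rho> x p = g p" if p: "p \<in> F" for p
      proof -
        have pX: "p \<in> X" using p F(2) by blast
        have "?\<sigma> x (b p) = f (b p)" using x(2) p by blast
        then have "b (\<rho> x p) = f (b p)" using pX by (simp add: bY)
        then show ?thesis using pX x(1) by (metis bY(2) g_def rep_in restrict_apply')
      qed
      then show "\<exists>x\<in>carrier M. \<forall>p\<in>F. \<rho> x p = g p" using x(1) by blast
    qed
    then obtain x where x: "x \<in> carrier M" "g = \<rho> x" by blast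
    have "?\<sigma> x = f"
    proof
      fix q show "?\<sigma> x q = f q"
      proof (cases "q \<in> Y")
        case True
        then show ?thesis by (simp add: x(2)[symmetric] g_def inv fY)
      next
        case False
        then show ?thesis using PiE_arb[OF f] by simp
      qed
    qed
    then show ?thesis using x(1) by blast
  qed
qed

section \<open>The first-difference ultrametric\<close>

locale countable_closed_representation = closed_representation +
  assumes countable_points: "countable X"
begin

text \<open>
  For \<open>x = y\<close> the set of indices is empty and the value is arbitrary; the metric below
  treats this case separately.
\<close>

definition first_difference :: "'a \<Rightarrow> 'a \<Rightarrow> nat" where
  "first_difference x y = (LEAST n. \<exists>p\<in>X. to_nat_on X p = n \<and> \<rho> x p \<noteq> \<rho> y p)"

definition difference_metric :: "'a \<Rightarrow> 'a \<Rightarrow> real" where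
  "difference_metric x y = (if x = y then 0 else 1 / real (Suc (first_difference x y)))"

text \<open>
  This lemma and the next one determine the metric: the distance is attained at some point where the two
  maps differ, and every such point bounds it from below. All further properties are read off from these
  two facts.
\<close>

lemma difference_metric_witness:
  assumes "x \<in> carrier M" "y \<in> carrier M" "x \<noteq> y"
  obtains p where "p \<in> X" "\<rho> x p \<noteq> \<rho> y p"
    "difference_metric x y = 1 / real (Suc (to_nat_on X p))"
proof -
  obtain q where "q \<in> X" "\<rho> x q \<noteq> \<rho> y q"
    using rep_eqI[OF assms(1,2)] assms(3) by blast
  then have "\<exists>n. \<exists>p\<in>X. to_nat_on X p = n \<and> \<rho> x p \<noteq> \<rho> y p" by blast
  then have "\<exists>p\<in>X. to_nat_on X p = first_difference x y \<and> \<rho> x p \<noteq> \<rho> y p"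
    unfolding first_difference_def by (rule LeastI_ex)
  with assms(3) show thesis by (auto simp: difference_metric_def intro!: that)
qed

lemma difference_metric_ge:
  assumes "p \<in> X" "\<rho> x p \<noteq> \<rho> y p"
  shows "1 / real (Suc (to_nat_on X p)) \<le> difference_metric x y"
proof -
  have "first_difference x y \<le> to_nat_on X p"
    unfolding first_difference_def using assms by (intro Least_le) blast
  moreover have "x \<noteq> y" using assms(2) by blast
  ultimately show ?thesis by (simp add: difference_metric_def frac_le)
qed

lemma difference_metric_less_imp_agree:
  assumes "p \<in> X" "difference_metric x y < 1 / real (Suc (to_nat_on X p))"
  shows "\<rho> x p = \<rho> y p"
  using difference_metric_ge[OF assms(1), of x y] assms(2) by linarith

lemma difference_metric_nonneg: "0 \<le> difference_metric x y"
  by (simp add: difference_metric_def)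

lemma difference_metric_ultra:
  assumes "x \<in> carrier M" "y \<in> carrier M" "z \<in> carrier M"
  shows "difference_metric x z \<le> max (difference_metric x y) (difference_metric y z)"
proof (cases "x = z")
  case True
  then show ?thesis using difference_metric_nonneg[of x y] by (simp add: difference_metric_def)
next
  case False
  then obtain p where p: "p \<in> X" "\<rho> x p \<noteq> \<rho> z p"
    "difference_metric x z = 1 / real (Suc (to_nat_on X p))"
    using difference_metric_witness assms by blast
  then have "\<rho> x p \<noteq> \<rho> y p \<or> \<rho> y p \<noteq> \<rho> z p" by metis
  then show ?thesis
    using difference_metric_ge[OF p(1), of x y] difference_metric_ge[OF p(1), of y z] p(3)
    by (auto simp: max_def)
qed

sublocale Metric_space "carrier M" difference_metric
proof
  show "0 \<le> difference_metric x y" for x y by (rule difference_metric_nonneg)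
  show "difference_metric x y = difference_metric y x" for x y
  proof -
    have "first_difference x y = first_difference y x"
      unfolding first_difference_def by (intro arg_cong[where f = Least] ext) metis
    then show ?thesis by (auto simp: difference_metric_def)
  qed
  show "difference_metric x y = 0 \<longleftrightarrow> x = y" if "x \<in> carrier M" "y \<in> carrier M" for x y
    by (simp add: difference_metric_def)
  show "difference_metric x z \<le> difference_metric x y + difference_metric y z"
    if "x \<in> carrier M" "y \<in> carrier M" "z \<in> carrier M" for x y z
    using difference_metric_ultra[OF that] difference_metric_nonneg[of x y]
      difference_metric_nonneg[of y z] by linarith
qed

lemma ultrametric_difference_metric: "ultrametric_on (carrier M) difference_metric"
  unfolding ultrametric_on_def using difference_metric_ultra Metric_space_axioms by blast

text \<open>
  If \<open>g f\<close> and \<open>g f'\<close> differ at \<open>p\<close>, then already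
  \<open>f\<close> and \<open>f'\<close> differ at \<open>p\<close>; hence the first difference cannot
  move to an earlier index under left multiplication.
\<close>

lemma left_non_expansive_difference_metric: "left_non_expansive M difference_metric"
  unfolding left_non_expansive_def
proof (intro ballI)
  fix g f f' assume m: "g \<in> carrier M" "f \<in> carrier M" "f' \<in> carrier M"
  show "difference_metric (g \<otimes> f) (g \<otimes> f') \<le> difference_metric f f'"
  proof (cases "g \<otimes> f = g \<otimes> f'")
    case True
    then show ?thesis using difference_metric_nonneg by (simp add: difference_metric_def)
  next
    case False
    then obtain p where p: "p \<in> X" "\<rho> (g \<otimes> f) p \<noteq> \<rho> (g \<otimes> f') p"
      "difference_metric (g \<otimes> f) (g \<otimes> f') = 1 / real (Suc (to_nat_on X p))"
      using difference_metric_witness[OF m_closed[OF m(1,2)] m_closed[OF m(1,3)] False] by blast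
    then have "\<rho> f p \<noteq> \<rho> f' p" using m by (auto simp: rep_mult)
    then show ?thesis using difference_metric_ge[OF p(1)] p(3) by simp
  qed
qed

text \<open>
  A ball of radius \<open>1 / (n + 1)\<close> consists of the maps that agree with its centre on the
  finitely many points of index at most \<open>n\<close>, and every finite set of points is contained in
  such an initial segment.
\<close>

lemma mtopology_eq: "mtopology = T"
proof (rule topology_eq[THEN iffD2], rule allI)
  fix W
  have "(\<exists>r>0. mball x r \<subseteq> W) \<longleftrightarrow>
    (\<exists>F. finite F \<and> F \<subseteq> X \<and> (\<forall>y\<in>carrier M. (\<forall>p\<in>F. \<rho> y p = \<rho> x p) \<longrightarrow> y \<in> W))"
    (is "?L \<longleftrightarrow> ?R") if x: "x \<in> carrier M" for x
  proof
    assume ?L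
    then obtain r where r: "r > 0" "mball x r \<subseteq> W" by blast
    then obtain n where n: "1 / real (Suc n) < r" using nat_approx_posE by blast
    define F where "F = {p \<in> X. to_nat_on X p \<le> n}"
    have "finite F"
    proof (rule finite_imageD)
      show "finite (to_nat_on X ` F)"
        by (rule finite_subset[of _ "{..n}"]) (auto simp: F_def)
      show "inj_on (to_nat_on X) F"
        using countable_points by (auto simp: F_def inj_on_def)
    qed
    moreover have "F \<subseteq> X" by (auto simp: F_def)
    moreover have "y \<in> W" if y: "y \<in> carrier M" "\<forall>p\<in>F. \<rho> y p = \<rho> x p" for y
    proof (cases "y = x")
      case True
      then show ?thesis using r x by auto
    next
      case False
      then obtain p where p: "p \<in> X" "\<rho> x p \<noteq> \<rho> y p"
        "difference_metric x y = 1 / real (Suc (to_nat_on X p))"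
        using difference_metric_witness[OF x y(1)] by metis
      then have "n < to_nat_on X p" using y(2) p(1,2) by (force simp: F_def not_less[symmetric])
      then have "1 / real (Suc (to_nat_on X p)) \<le> 1 / real (Suc n)" by (simp add: frac_le)
      then have "y \<in> mball x r" using p(3) n x y(1) by simp
      then show ?thesis using r(2) by blast
    qed
    ultimately show ?R by blast
  next
    assume ?R
    then obtain F where F: "finite F" "F \<subseteq> X"
      "\<And>y. y \<in> carrier M \<Longrightarrow> \<forall>p\<in>F. \<rho> y p = \<rho> x p \<Longrightarrow> y \<in> W" by metis
    obtain n where n: "\<And>p. p \<in> F \<Longrightarrow> to_nat_on X p \<le> n"
      using finite_imageI[OF F(1), of "to_nat_on X"] unfolding finite_nat_set_iff_bounded_le by blast
    have "y \<in> W" if y: "y \<in> mball x (1 / real (Suc n))" for y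
    proof (rule F(3))
      show "y \<in> carrier M" using y by simp
      show "\<forall>p\<in>F. \<rho> y p = \<rho> x p"
      proof
        fix p assume p: "p \<in> F"
        have "1 / real (Suc n) \<le> 1 / real (Suc (to_nat_on X p))" using n[OF p] by (simp add: frac_le)
        then have "difference_metric x y < 1 / real (Suc (to_nat_on X p))" using y by simp
        then show "\<rho> y p = \<rho> x p" using difference_metric_less_imp_agree p F(2) by (metis subsetD)
      qed
    qed
    then show ?L by (intro exI[of _ "1 / real (Suc n)"]) auto
  qed
  note eq = this
  have "openin mtopology W \<longleftrightarrow> W \<subseteq> carrier M \<and> (\<forall>x\<in>W. \<exists>r>0. mball x r \<subseteq> W)"
    unfolding openin_mtopology by (simp add: Ball_def)
  also have "\<dots> \<longleftrightarrow> openin T W"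
    unfolding openin_iff_agree[of W]
    by (rule conj_cong[OF refl], rule ball_cong[OF refl], rule eq, erule (1) subsetD)
  finally show "openin mtopology W \<longleftrightarrow> openin T W" .
qed

text \<open>
  Along a Cauchy sequence the value at each point is eventually constant. The map \<open>f\<close> of
  eventual values agrees with late members of the sequence on any finite set, so it is represented
  because the image is closed.
\<close>

lemma mcomplete_difference_metric: mcomplete
  unfolding mcomplete_def
proof (intro allI impI)
  fix \<sigma> assume C: "MCauchy \<sigma>"
  then have \<sigma>: "\<sigma> n \<in> carrier M" for n by (auto simp: MCauchy_def)
  have "\<exists>N. \<forall>n\<ge>N. \<rho> (\<sigma> N) p = \<rho> (\<sigma> n) p" if p: "p \<in> X" for p
  proof -
    have "1 / real (Suc (to_nat_on X p)) > 0" by simp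
    then obtain N where "\<And>n n'. N \<le> n \<Longrightarrow> N \<le> n' \<Longrightarrow>
        difference_metric (\<sigma> n) (\<sigma> n') < 1 / real (Suc (to_nat_on X p))"
      using C unfolding MCauchy_def by meson
    then show ?thesis using difference_metric_less_imp_agree[OF p] by blast
  qed
  then obtain N where N: "\<And>p n. p \<in> X \<Longrightarrow> N p \<le> n \<Longrightarrow> \<rho> (\<sigma> (N p)) p = \<rho> (\<sigma> n) p" by metis
  define f where "f = (\<lambda>p\<in>X. \<rho> (\<sigma> (N p)) p)"
  have stable: "\<exists>m. \<forall>n\<ge>m. \<forall>p\<in>F. \<rho> (\<sigma> n) p = f p" if F: "finite F" "F \<subseteq> X" for F
  proof -
    obtain m where m: "\<And>p. p \<in> F \<Longrightarrow> N p \<le> m"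
      using finite_imageI[OF F(1), of N] unfolding finite_nat_set_iff_bounded_le by blast
    have "\<rho> (\<sigma> n) p = f p" if "m \<le> n" "p \<in> F" for n p
    proof -
      have "p \<in> X" using that F(2) by blast
      moreover have "N p \<le> n" using m[OF that(2)] that(1) by linarith
      ultimately show ?thesis using N[of p n] by (simp add: f_def)
    qed
    then show ?thesis by blast
  qed
  have "f \<in> \<rho> ` carrier M"
  proof (rule limit_represented)
    show "f \<in> X \<rightarrow>\<^sub>E X" using rep_in \<sigma> by (auto simp: f_def)
    show "\<exists>x\<in>carrier M. \<forall>p\<in>F. \<rho> x p = f p" if "finite F" "F \<subseteq> X" for F
      using stable[OF that] \<sigma> by blast
  qed
  then obtain x where x: "x \<in> carrier M" "f = \<rho> x" by blast
  have "eventually (\<lambda>n. \<sigma> n \<in> W) sequentially" if W: "openin T W" "x \<in> W" for W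
  proof -
    obtain F where F: "finite F" "F \<subseteq> X" "\<forall>y\<in>carrier M. (\<forall>p\<in>F. \<rho> y p = \<rho> x p) \<longrightarrow> y \<in> W"
      using W unfolding openin_iff_agree[of W] by blast
    obtain m where "\<forall>n\<ge>m. \<forall>p\<in>F. \<rho> (\<sigma> n) p = f p" using stable[OF F(1,2)] by blast
    then have "\<forall>n\<ge>m. \<sigma> n \<in> W" using F(3) \<sigma> x(2) by simp
    then show ?thesis unfolding eventually_sequentially by blast
  qed
  then have "limitin mtopology \<sigma> x sequentially"
    unfolding mtopology_eq limitin_def using x(1) topspace_eq by simp
  then show "\<exists>x. limitin mtopology \<sigma> x sequentially" ..
qed

text \<open>
  For each of the countably many finite pieces of the graph of a represented map, choose one element of
  the monoid whose map extends it.
\<close>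

lemma separable: "separable_space T"
proof -
  define D where "D = {A. finite A \<and> A \<subseteq> X \<times> X \<and> (\<exists>x\<in>carrier M. \<forall>(p, q)\<in>A. \<rho> x p = q)}"
  define c where "c A = (SOME x. x \<in> carrier M \<and> (\<forall>(p, q)\<in>A. \<rho> x p = q))" for A
  have c: "c A \<in> carrier M \<and> (\<forall>(p, q)\<in>A. \<rho> (c A) p = q)" if "A \<in> D" for A
    unfolding c_def by (rule someI_ex) (use that in \<open>auto simp: D_def\<close>)
  have "countable D"
    by (rule countable_subset[OF _ countable_Collect_finite_subset[of "X \<times> X"]])
      (auto simp: D_def countable_points)
  moreover have "T closure_of (c ` D) = topspace T"
  proof (rule antisym[OF closure_of_subset_topspace], rule subsetI)
    fix x assume "x \<in> topspace T"
    then have x: "x \<in> carrier M" by (simp add: topspace_eq)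
    have "\<exists>y\<in>c ` D. y \<in> W" if W: "x \<in> W" "openin T W" for W
    proof -
      obtain F where F: "finite F" "F \<subseteq> X" "\<forall>y\<in>carrier M. (\<forall>p\<in>F. \<rho> y p = \<rho> x p) \<longrightarrow> y \<in> W"
        using W unfolding openin_iff_agree[of W] by blast
      define A where "A = (\<lambda>p. (p, \<rho> x p)) ` F"
      have "A \<in> D" using F(1,2) x rep_in unfolding A_def D_def by auto
      then have "c A \<in> W" using c[of A] F(3) by (auto simp: A_def)
      with \<open>A \<in> D\<close> show ?thesis by blast
    qed
    then show "x \<in> T closure_of (c ` D)" using x by (auto simp: in_closure_of topspace_eq)
  qed
  ultimately show ?thesis
    unfolding separable_space_def using c topspace_eq by (intro exI[of _ "c ` D"]) auto
qed

end

section \<open>From ultrametrics to uniformities\<close>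

text \<open>
  Metric completeness concerns sequences, completeness of a uniformity concerns filters. Picking the
  \<open>n\<close>-th term from the intersection of the first \<open>n + 1\<close> small sets of the
  filter yields a Cauchy sequence, and its limit is also the limit of the filter.
\<close>

lemma (in Metric_space) Cauchy_filter_converges:
  assumes complete: mcomplete and \<F>: "\<F> \<noteq> bot" "\<F> \<le> principal M"
    and Cauchy: "\<And>n. \<exists>A. (\<forall>\<^sub>F x in \<F>. x \<in> A) \<and> (\<forall>x\<in>A. \<forall>y\<in>A. d x y < 1 / real (Suc n))"
  shows "\<exists>x\<in>M. \<forall>n. \<forall>\<^sub>F y in \<F>. d x y < 1 / real (Suc n)"
proof -
  obtain A where A: "\<And>n. \<forall>\<^sub>F x in \<F>. x \<in> A n"
    "\<And>n x y. x \<in> A n \<Longrightarrow> y \<in> A n \<Longrightarrow> d x y < 1 / real (Suc n)" using Cauchy by metis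
  have M: "\<forall>\<^sub>F x in \<F>. x \<in> M" using \<F>(2) by (simp add: le_principal)
  have "\<exists>x. x \<in> M \<and> (\<forall>k\<le>n. x \<in> A k)" for n
  proof -
    have "\<forall>\<^sub>F x in \<F>. \<forall>k\<in>{..n}. x \<in> A k" by (rule eventually_ball_finite) (auto simp: A(1))
    with M have "\<forall>\<^sub>F x in \<F>. x \<in> M \<and> (\<forall>k\<in>{..n}. x \<in> A k)" by (rule eventually_conj)
    from eventually_happens'[OF \<F>(1) this] show ?thesis by auto
  qed
  then obtain \<sigma> where \<sigma>: "\<And>n. \<sigma> n \<in> M" "\<And>n k. k \<le> n \<Longrightarrow> \<sigma> n \<in> A k" by metis
  have "MCauchy \<sigma>"
    unfolding MCauchy_def
  proof (intro conjI allI impI)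
    show "range \<sigma> \<subseteq> M" using \<sigma>(1) by blast
    fix \<epsilon> :: real assume "\<epsilon> > 0"
    then obtain k where k: "1 / real (Suc k) < \<epsilon>" using nat_approx_posE by blast
    have "d (\<sigma> n) (\<sigma> n') < \<epsilon>" if "k \<le> n" "k \<le> n'" for n n'
      using A(2)[OF \<sigma>(2)[OF that(1)] \<sigma>(2)[OF that(2)]] k by linarith
    then show "\<exists>N. \<forall>n n'. N \<le> n \<longrightarrow> N \<le> n' \<longrightarrow> d (\<sigma> n) (\<sigma> n') < \<epsilon>" by blast
  qed
  then obtain x where x: "limitin mtopology \<sigma> x sequentially"
    using complete unfolding mcomplete_def by blast
  then have xM: "x \<in> M" and lim: "\<And>\<epsilon>. \<epsilon> > 0 \<Longrightarrow> \<forall>\<^sub>F n in sequentially. \<sigma> n \<in> M \<and> d (\<sigma> n) x < \<epsilon>"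
    by (auto simp: limit_metric_sequentially eventually_sequentially)
  have "\<forall>\<^sub>F y in \<F>. d x y < 1 / real (Suc n)" for n
  proof -
    \<comment> \<open>This index makes two errors of size \<open>1 / (k + 1)\<close> add up to \<open>1 / (n + 1)\<close>.\<close>
    define k where "k = 2 * n + 1"
    have k: "1 / real (Suc k) = (1 / real (Suc n)) / 2" by (simp add: k_def field_simps)
    have "\<forall>\<^sub>F m in sequentially. m \<ge> k \<and> \<sigma> m \<in> M \<and> d (\<sigma> m) x < 1 / real (Suc k)"
      using eventually_conj[OF eventually_ge_at_top[of k] lim[of "1 / real (Suc k)"]] by simp
    then obtain m where m: "m \<ge> k" "d (\<sigma> m) x < 1 / real (Suc k)"
      using eventually_happens' sequentially_bot by blast
    have close: "d x y < 1 / real (Suc n)" if y: "y \<in> M" "y \<in> A k" for y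
    proof -
      have "d (\<sigma> m) y < 1 / real (Suc k)" using A(2)[OF \<sigma>(2)[OF m(1)] y(2)] .
      moreover have "d x y \<le> d x (\<sigma> m) + d (\<sigma> m) y" using triangle xM \<sigma>(1) y(1) by blast
      moreover have "d x (\<sigma> m) = d (\<sigma> m) x" by (rule commute)
      ultimately have "d x y < 1 / real (Suc k) + 1 / real (Suc k)" using m(2) by linarith
      then show ?thesis unfolding k by (simp only: field_sum_of_halves)
    qed
    show ?thesis
      by (rule eventually_mono[OF eventually_conj[OF M A(1)[of k]]]) (elim conjE, rule close)
  qed
  with xM show ?thesis by blast
qed

text \<open>
  The strong triangle inequality makes each relation \<open>E n\<close> of being at distance less than
  \<open>1 / (n + 1)\<close> transitive. A dense set meets every class of \<open>E n\<close>, since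
  classes are balls.
\<close>

lemma left_invariant_uniformity_of_ultrametric:
  assumes d: "ultrametric_on (carrier M) d" and T: "Metric_space.mtopology (carrier M) d = T"
    and complete: "Metric_space.mcomplete (carrier M) d"
    and left: "left_non_expansive M d" and sep: "separable_space T" and "monoid M"
  shows "Hausdorff_space T \<and>
       (\<exists>\<U> \<B>. uniformity_on_set (carrier M) \<U> \<and>
              compatible_uniformity T \<U> \<and>
              complete_uniformity (carrier M) \<U> \<and>
              uniformity_base \<U> \<B> \<and> countable \<B> \<and>
              (\<forall>U\<in>\<B>. equiv (carrier M) U \<and> countable (carrier M // U)) \<and>
              (\<forall>U\<in>\<B>. \<forall>x\<in>carrier M. \<forall>y\<in>carrier M. \<forall>z\<in>carrier M.
                 (y, z) \<in> U \<longrightarrow> (x \<otimes>\<^bsub>M\<^esub> y, x \<otimes>\<^bsub>M\<^esub> z) \<in> U))"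
proof
  interpret monoid M by fact
  interpret Metric_space "carrier M" d using d by (simp add: ultrametric_on_def)
  have ultra: "d x z \<le> max (d x y) (d y z)" if "x \<in> carrier M" "y \<in> carrier M" "z \<in> carrier M" for x y z
    using d that by (simp add: ultrametric_on_def)
  show "Hausdorff_space T" using Hausdorff_space_mtopology T by simp
  define E where "E n = {(x, y). x \<in> carrier M \<and> y \<in> carrier M \<and> d x y < 1 / real (Suc n)}" for n
  define \<U> where "\<U> = {V. V \<subseteq> carrier M \<times> carrier M \<and> (\<exists>n. E n \<subseteq> V)}"
  have ball: "{y. (x, y) \<in> E n} = mball x (1 / real (Suc n))" for x n
    by (auto simp: E_def)
  have equivE: "equiv (carrier M) (E n)" for n
  proof (rule equivI)
    show "E n \<subseteq> carrier M \<times> carrier M" by (auto simp: E_def)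
    show "refl_on (carrier M) (E n)" by (auto simp: refl_on_def E_def)
    show "sym (E n)" by (auto simp: sym_def E_def commute)
    show "trans (E n)"
    proof (rule transI)
      fix x y z assume "(x, y) \<in> E n" "(y, z) \<in> E n"
      then show "(x, z) \<in> E n" using ultra[of x y z] by (auto simp: E_def)
    qed
  qed
  have antimono: "E n \<subseteq> E m" if "m \<le> n" for m n
  proof -
    have "1 / real (Suc n) \<le> 1 / real (Suc m)" using that by (simp add: frac_le)
    then show ?thesis by (auto simp: E_def)
  qed
  have EU: "E n \<in> \<U>" for n using equivE[of n] by (auto simp: \<U>_def equiv_def)
  have unif: "uniformity_on_set (carrier M) \<U>"
    unfolding uniformity_on_set_def
  proof (intro conjI ballI allI impI)
    show "\<U> \<noteq> {}" using EU by blast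
    fix U assume "U \<in> \<U>"
    then obtain n where U: "U \<subseteq> carrier M \<times> carrier M" "E n \<subseteq> U" by (auto simp: \<U>_def)
    show "U \<subseteq> carrier M \<times> carrier M" by fact
    show "refl_on (carrier M) U" using U(2) equivE[of n] by (auto simp: equiv_def refl_on_def)
    show "U\<inverse> \<in> \<U>"
    proof -
      have "E n \<subseteq> U\<inverse>" using U(2) equivE[of n] by (auto simp: equiv_def sym_def)
      then show ?thesis using U(1) by (auto simp: \<U>_def)
    qed
    show "\<exists>V\<in>\<U>. V O V \<subseteq> U"
    proof (rule bexI[OF _ EU[of n]])
      have "E n O E n \<subseteq> E n" using equivE[of n] by (simp add: equiv_def trans_O_subset)
      then show "E n O E n \<subseteq> U" using U(2) by blast
    qed
    show "V \<in> \<U>" if "U \<subseteq> V \<and> V \<subseteq> carrier M \<times> carrier M" for V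
      using that U(2) by (auto simp: \<U>_def)
    show "U \<inter> V \<in> \<U>" if V: "V \<in> \<U>" for V
    proof -
      obtain m where "E m \<subseteq> V" using V by (auto simp: \<U>_def)
      then have "E (max n m) \<subseteq> U \<inter> V" using U(2) antimono[of n "max n m"] antimono[of m "max n m"] by auto
      then show ?thesis using U(1) by (auto simp: \<U>_def)
    qed
  qed
  have compat: "compatible_uniformity T \<U>"
    unfolding compatible_uniformity_def
  proof
    fix S
    have "(\<exists>r>0. mball x r \<subseteq> S) \<longleftrightarrow> (\<exists>U\<in>\<U>. {y. (x, y) \<in> U} \<subseteq> S)" for x
    proof
      assume "\<exists>r>0. mball x r \<subseteq> S"
      then obtain r where r: "r > 0" "mball x r \<subseteq> S" by blast
      then obtain n where n: "1 / real (Suc n) < r" using nat_approx_posE by blast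
      have "{y. (x, y) \<in> E n} \<subseteq> S" using r(2) n unfolding ball by (auto simp: subset_iff)
      then show "\<exists>U\<in>\<U>. {y. (x, y) \<in> U} \<subseteq> S" using EU by blast
    next
      assume "\<exists>U\<in>\<U>. {y. (x, y) \<in> U} \<subseteq> S"
      then obtain n where "{y. (x, y) \<in> E n} \<subseteq> S" by (auto simp: \<U>_def)
      then show "\<exists>r>0. mball x r \<subseteq> S" unfolding ball by (intro exI[of _ "1 / real (Suc n)"]) simp
    qed
    then show "openin T S \<longleftrightarrow> S \<subseteq> topspace T \<and> (\<forall>x\<in>S. \<exists>U\<in>\<U>. {y. (x, y) \<in> U} \<subseteq> S)"
      unfolding T[symmetric] openin_mtopology topspace_mtopology by (simp add: Ball_def)
  qed
  have compl: "complete_uniformity (carrier M) \<U>"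
    unfolding complete_uniformity_def
  proof (intro allI impI)
    fix \<F> :: "'a filter"
    assume F: "\<F> \<noteq> bot \<and> \<F> \<le> principal (carrier M) \<and>
      (\<forall>U\<in>\<U>. \<exists>A. (\<forall>\<^sub>F x in \<F>. x \<in> A) \<and> A \<times> A \<subseteq> U)"
    have "\<exists>A. (\<forall>\<^sub>F x in \<F>. x \<in> A) \<and> (\<forall>x\<in>A. \<forall>y\<in>A. d x y < 1 / real (Suc n))" for n
    proof -
      obtain A where "\<forall>\<^sub>F x in \<F>. x \<in> A" "A \<times> A \<subseteq> E n" using F EU by meson
      then show ?thesis by (intro exI[of _ A]) (auto simp: E_def)
    qed
    then obtain x where x: "x \<in> carrier M" "\<And>n. \<forall>\<^sub>F y in \<F>. d x y < 1 / real (Suc n)"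
      using Cauchy_filter_converges[OF complete, of \<F>] F by blast
    have "\<forall>\<^sub>F y in \<F>. (x, y) \<in> U" if U: "U \<in> \<U>" for U
    proof -
      obtain n where n: "E n \<subseteq> U" using U by (auto simp: \<U>_def)
      have "\<forall>\<^sub>F y in \<F>. y \<in> carrier M" using F by (simp add: le_principal)
      then show ?thesis using x(2)[of n]
        by eventually_elim (use n x(1) in \<open>auto simp: E_def\<close>)
    qed
    with x(1) show "\<exists>x\<in>carrier M. \<forall>U\<in>\<U>. \<forall>\<^sub>F y in \<F>. (x, y) \<in> U" by blast
  qed
  have base: "uniformity_base \<U> (range E)"
    unfolding uniformity_base_def using EU by (auto simp: \<U>_def)
  have classes: "countable (carrier M // E n)" for n
  proof -
    obtain C where C: "countable C" "C \<subseteq> carrier M" "T closure_of C = carrier M"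
      using sep T unfolding separable_space_def by auto
    have "\<exists>c\<in>C. (c, x) \<in> E n" if x: "x \<in> carrier M" for x
    proof -
      have "x \<in> T closure_of C" using C(3) x by simp
      moreover have "openin T (mball x (1 / real (Suc n)))" using T openin_mball by blast
      moreover have "x \<in> mball x (1 / real (Suc n))" using x by simp
      ultimately obtain c where "c \<in> C" "c \<in> mball x (1 / real (Suc n))"
        unfolding in_closure_of by blast
      then show ?thesis by (auto simp: E_def commute)
    qed
    then have "carrier M // E n \<subseteq> (\<lambda>c. E n `` {c}) ` C"
      by (auto elim!: quotientE) (metis equiv_class_eq[OF equivE[of n]] image_eqI)
    then show ?thesis by (rule countable_subset) (simp add: C(1))
  qed
  have left_inv: "(x \<otimes>\<^bsub>M\<^esub> y, x \<otimes>\<^bsub>M\<^esub> z) \<in> E n"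
    if "x \<in> carrier M" "y \<in> carrier M" "z \<in> carrier M" "(y, z) \<in> E n" for n x y z
  proof -
    have "d (x \<otimes>\<^bsub>M\<^esub> y) (x \<otimes>\<^bsub>M\<^esub> z) \<le> d y z" using left that(1-3) by (simp add: left_non_expansive_def)
    then show ?thesis using that by (auto simp: E_def)
  qed
  show "\<exists>\<U> \<B>. uniformity_on_set (carrier M) \<U> \<and> compatible_uniformity T \<U> \<and>
      complete_uniformity (carrier M) \<U> \<and> uniformity_base \<U> \<B> \<and> countable \<B> \<and>
      (\<forall>U\<in>\<B>. equiv (carrier M) U \<and> countable (carrier M // U)) \<and>
      (\<forall>U\<in>\<B>. \<forall>x\<in>carrier M. \<forall>y\<in>carrier M. \<forall>z\<in>carrier M.
         (y, z) \<in> U \<longrightarrow> (x \<otimes>\<^bsub>M\<^esub> y, x \<otimes>\<^bsub>M\<^esub> z) \<in> U)"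
    by (rule exI[of _ \<U>], rule exI[of _ "range E"])
      (use unif compat compl base equivE classes left_inv in simp)
qed

section \<open>The representation on equivalence classes\<close>

locale left_invariant_uniform_monoid = monoid M
  for M :: "('a, 'm) monoid_scheme" (structure) and T :: "'a topology"
    and \<U> \<B> :: "'a rel set" +
  assumes topological: "topological_monoid M T" and Hausdorff: "Hausdorff_space T"
    and uniformity: "uniformity_on_set (carrier M) \<U>"
    and compatible: "compatible_uniformity T \<U>"
    and complete: "complete_uniformity (carrier M) \<U>"
    and base: "uniformity_base \<U> \<B>" and countable_base: "countable \<B>"
    and base_equiv: "U \<in> \<B> \<Longrightarrow> equiv (carrier M) U"
    and countable_classes: "U \<in> \<B> \<Longrightarrow> countable (carrier M // U)"
    and base_left_invariant: "\<lbrakk>U \<in> \<B>; x \<in> carrier M; y \<in> carrier M; z \<in> carrier M; (y, z) \<in> U\<rbrakk>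
      \<Longrightarrow> (x \<otimes> y, x \<otimes> z) \<in> U"
begin

lemma topspace_carrier: "topspace T = carrier M"
  using topological by (simp add: topological_monoid_def)

lemma base_nonempty: "\<B> \<noteq> {}"
proof -
  have "\<U> \<noteq> {}"
    using uniformity unfolding uniformity_on_set_def by (elim conjE) assumption
  then show ?thesis using base unfolding uniformity_base_def by blast
qed

lemma base_directed:
  assumes "finite \<V>" "\<V> \<subseteq> \<B>"
  shows "\<exists>W\<in>\<B>. \<forall>V\<in>\<V>. W \<subseteq> V"
  using assms
proof (induction \<V> rule: finite_induct)
  case empty
  then show ?case using base_nonempty by blast
next
  case (insert U \<V>)
  then obtain W where W: "W \<in> \<B>" "\<forall>V\<in>\<V>. W \<subseteq> V" by blast
  have "U \<in> \<U>" "W \<in> \<U>" using W(1) insert.prems base by (auto simp: uniformity_base_def)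
  moreover have "\<forall>U\<in>\<U>. \<forall>V\<in>\<U>. U \<inter> V \<in> \<U>"
    using uniformity unfolding uniformity_on_set_def by (elim conjE) assumption
  ultimately have "U \<inter> W \<in> \<U>" by blast
  then obtain W' where "W' \<in> \<B>" "W' \<subseteq> U \<inter> W" using base unfolding uniformity_base_def by meson
  then show ?case using W(2) by blast
qed

lemma openin_iff_base:
  "openin T W \<longleftrightarrow> W \<subseteq> carrier M \<and> (\<forall>x\<in>W. \<exists>U\<in>\<B>. {y. (x, y) \<in> U} \<subseteq> W)"
proof -
  have "(\<exists>U\<in>\<U>. {y. (x, y) \<in> U} \<subseteq> W) \<longleftrightarrow> (\<exists>U\<in>\<B>. {y. (x, y) \<in> U} \<subseteq> W)" for x
  proof
    assume "\<exists>U\<in>\<U>. {y. (x, y) \<in> U} \<subseteq> W"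
    then obtain U where U: "U \<in> \<U>" "{y. (x, y) \<in> U} \<subseteq> W" by blast
    then obtain V where "V \<in> \<B>" "V \<subseteq> U" using base unfolding uniformity_base_def by meson
    with U(2) show "\<exists>U\<in>\<B>. {y. (x, y) \<in> U} \<subseteq> W" by blast
  next
    assume "\<exists>U\<in>\<B>. {y. (x, y) \<in> U} \<subseteq> W"
    then show "\<exists>U\<in>\<U>. {y. (x, y) \<in> U} \<subseteq> W" using base unfolding uniformity_base_def by blast
  qed
  then show ?thesis
    using compatible unfolding compatible_uniformity_def topspace_carrier by simp
qed

lemma openin_class:
  assumes U: "U \<in> \<B>"
  shows "openin T (U `` {x})"
  unfolding openin_iff_base
proof (intro conjI ballI)
  note eq = base_equiv[OF U]
  show "U `` {x} \<subseteq> carrier M" using eq by (auto simp: equiv_def)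
  fix y assume "y \<in> U `` {x}"
  then have "{z. (y, z) \<in> U} \<subseteq> U `` {x}" using eq by (auto simp: equiv_def dest: transD)
  with U show "\<exists>V\<in>\<B>. {z. (y, z) \<in> V} \<subseteq> U `` {x}" by blast
qed

text \<open>
  Left multiplications preserve the base by assumption; right multiplications need not. They are
  continuous, however, and classes are open, which gives this uniform control at a fixed
  \<open>x\<close>.
\<close>

lemma right_multiplication_uniform_at:
  assumes U: "U \<in> \<B>" and x: "x \<in> carrier M" and c: "c \<in> carrier M"
  shows "\<exists>W\<in>\<B>. \<forall>y. (x, y) \<in> W \<longrightarrow> (x \<otimes> c, y \<otimes> c) \<in> U"
proof -
  have "continuous_map T T (\<lambda>y. (\<lambda>(x, y). x \<otimes> y) (y, c))"
  proof (rule continuous_map_compose[of T "prod_topology T T" "\<lambda>y. (y, c)", unfolded o_def])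
    show "continuous_map T (prod_topology T T) (\<lambda>y. (y, c))"
      using c by (simp add: continuous_map_paired topspace_carrier)
    show "continuous_map (prod_topology T T) T (\<lambda>(x, y). x \<otimes> y)"
      using topological by (simp add: topological_monoid_def)
  qed
  then have "openin T {y \<in> topspace T. y \<otimes> c \<in> U `` {x \<otimes> c}}"
    using openin_class[OF U, of "x \<otimes> c"] by (simp add: continuous_map del: Image_singleton_iff)
  moreover have "x \<in> {y \<in> topspace T. y \<otimes> c \<in> U `` {x \<otimes> c}}"
    using x c base_equiv[OF U] by (simp add: topspace_carrier equiv_def refl_on_def)
  ultimately show ?thesis unfolding openin_iff_base by blast
qed

text \<open>
  A point is a class, tagged with its relation so that the quotients are disjoint, together with a
  natural number on which the monoid acts trivially. The infinitely many copies make the set infinite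
  even when there are only finitely many classes.
\<close>

definition points :: "(('a rel \<times> 'a set) \<times> nat) set" where
  "points = (SIGMA U:\<B>. carrier M // U) \<times> UNIV"

definition act :: "'a \<Rightarrow> ('a rel \<times> 'a set) \<times> nat \<Rightarrow> ('a rel \<times> 'a set) \<times> nat" where
  "act x = (\<lambda>((U, C), k)\<in>points. ((U, U `` ((\<otimes>) x ` C)), k))"

text \<open>
  Left invariance makes the action on a class independent of the chosen representative.
\<close>

lemma act_class:
  assumes U: "U \<in> \<B>" and x: "x \<in> carrier M" and c: "c \<in> carrier M"
  shows "act x ((U, U `` {c}), k) = ((U, U `` {x \<otimes> c}), k)"
proof -
  note eq = base_equiv[OF U]
  have "U `` ((\<otimes>) x ` (U `` {c})) = U `` {x \<otimes> c}"
  proof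
    show "U `` ((\<otimes>) x ` (U `` {c})) \<subseteq> U `` {x \<otimes> c}"
    proof
      fix z assume "z \<in> U `` ((\<otimes>) x ` (U `` {c}))"
      then obtain y where y: "(c, y) \<in> U" "(x \<otimes> y, z) \<in> U" by blast
      then have "(x \<otimes> c, x \<otimes> y) \<in> U"
        using base_left_invariant[OF U x c] eq by (auto simp: equiv_def)
      then show "z \<in> U `` {x \<otimes> c}" using y(2) eq by (auto simp: equiv_def dest: transD)
    qed
    show "U `` {x \<otimes> c} \<subseteq> U `` ((\<otimes>) x ` (U `` {c}))"
      using eq c by (auto simp: equiv_def refl_on_def)
  qed
  moreover have "((U, U `` {c}), k) \<in> points" using U c by (auto simp: points_def quotientI)
  ultimately show ?thesis by (simp add: act_def)
qed

lemma pointsE: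
  assumes "p \<in> points"
  obtains U c k where "U \<in> \<B>" "c \<in> carrier M" "p = ((U, U `` {c}), k)"
  using assms unfolding points_def by (auto elim!: quotientE)

lemma class_in_points: "\<lbrakk>U \<in> \<B>; c \<in> carrier M\<rbrakk> \<Longrightarrow> ((U, U `` {c}), k) \<in> points"
  by (auto simp: points_def quotientI)

text \<open>
  This translates agreement at a point into the uniformity; for \<open>c = 1\<close> it shows that the
  relation \<open>U\<close> itself is agreement at a single point.
\<close>

lemma act_class_eq_iff:
  assumes "U \<in> \<B>" "x \<in> carrier M" "y \<in> carrier M" "c \<in> carrier M"
  shows "act x ((U, U `` {c}), k) = act y ((U, U `` {c}), k) \<longleftrightarrow> (x \<otimes> c, y \<otimes> c) \<in> U"
  using assms by (simp add: act_class eq_equiv_class_iff[OF base_equiv])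

lemma act_one_eq_iff:
  assumes "U \<in> \<B>" "x \<in> carrier M" "y \<in> carrier M"
  shows "act x ((U, U `` {\<one>}), k) = act y ((U, U `` {\<one>}), k) \<longleftrightarrow> (x, y) \<in> U"
  using act_class_eq_iff[OF assms one_closed] assms(2,3) by simp

lemma act_locally_constant:
  assumes F: "finite F" "F \<subseteq> points" and x: "x \<in> carrier M"
  shows "\<exists>W\<in>\<B>. \<forall>y. (x, y) \<in> W \<longrightarrow> (\<forall>p\<in>F. act y p = act x p)"
proof -
  have "\<exists>W\<in>\<B>. \<forall>y. (x, y) \<in> W \<longrightarrow> act y p = act x p" if p: "p \<in> F" for p
  proof -
    obtain U c k where U: "U \<in> \<B>" "c \<in> carrier M" "p = ((U, U `` {c}), k)"
      using p F(2) by (blast elim: pointsE)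
    obtain W where W: "W \<in> \<B>" "\<forall>y. (x, y) \<in> W \<longrightarrow> (x \<otimes> c, y \<otimes> c) \<in> U"
      using right_multiplication_uniform_at[OF U(1) x U(2)] by blast
    have "act y p = act x p" if "(x, y) \<in> W" for y
    proof -
      have "y \<in> carrier M" using that base_equiv[OF W(1)] by (auto simp: equiv_def)
      then show ?thesis using act_class_eq_iff[OF U(1) x _ U(2)] W(2) that U(3) by metis
    qed
    with W(1) show ?thesis by blast
  qed
  then obtain w where w: "\<And>p. p \<in> F \<Longrightarrow> w p \<in> \<B>"
    "\<And>p y. p \<in> F \<Longrightarrow> (x, y) \<in> w p \<Longrightarrow> act y p = act x p" by metis
  obtain W where "W \<in> \<B>" "\<forall>V\<in>w ` F. W \<subseteq> V"
    using base_directed[of "w ` F"] F(1) w(1) by blast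
  then show ?thesis using w(2) by blast
qed

text \<open>
  The point \<open>e U\<close> is the class of \<open>1\<close> modulo \<open>U\<close>, and the
  elements acting like \<open>f\<close> on it form a class \<open>A U\<close> of \<open>U\<close>. These
  classes shrink along the base and so generate a Cauchy filter with a limit \<open>x\<close>, which
  acts like \<open>f\<close> at each \<open>e U\<close>. For an arbitrary point \<open>p\<close>, choose
  a relation \<open>W\<close> so fine that elements \<open>W\<close>-close to \<open>x\<close> act on
  \<open>p\<close> as \<open>x\<close> does, and an element \<open>y\<close> that agrees with
  \<open>f\<close> at both \<open>e W\<close> and \<open>p\<close>: agreement at \<open>e W\<close>
  makes \<open>y\<close> close to \<open>x\<close>.
\<close>

lemma approximated_map_represented:
  assumes f: "f \<in> points \<rightarrow>\<^sub>E points"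
    and ap: "\<And>F. \<lbrakk>finite F; F \<subseteq> points\<rbrakk> \<Longrightarrow> \<exists>x\<in>carrier M. \<forall>p\<in>F. act x p = f p"
  shows "\<exists>x\<in>carrier M. \<forall>p\<in>points. act x p = f p"
proof -
  define e where "e U = ((U, U `` {\<one>}), 0::nat)" for U :: "'a rel"
  have e: "e U \<in> points" if "U \<in> \<B>" for U using class_in_points[OF that one_closed] by (simp add: e_def)
  have e_iff: "act x (e U) = act y (e U) \<longleftrightarrow> (x, y) \<in> U"
    if "U \<in> \<B>" "x \<in> carrier M" "y \<in> carrier M" for U x y
    using act_one_eq_iff[OF that] by (simp add: e_def)
  define A where "A U = {x \<in> carrier M. act x (e U) = f (e U)}" for U
  have A_ne: "A U \<noteq> {}" if "U \<in> \<B>" for U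
    using ap[of "{e U}"] e[OF that] by (auto simp: A_def)
  have A_small: "A U \<times> A U \<subseteq> U" if "U \<in> \<B>" for U
    by (auto simp: A_def e_iff[OF that, symmetric])
  have A_mono: "A W \<subseteq> A U" if WU: "W \<in> \<B>" "U \<in> \<B>" "W \<subseteq> U" for U W
  proof
    fix x assume x: "x \<in> A W"
    obtain z where z: "z \<in> carrier M" "act z (e W) = f (e W)" "act z (e U) = f (e U)"
      using ap[of "{e W, e U}"] e[OF WU(1)] e[OF WU(2)] by auto
    have xM: "x \<in> carrier M" and "act x (e W) = act z (e W)" using x z by (simp_all add: A_def)
    then have "(x, z) \<in> U" using e_iff[OF WU(1) xM z(1)] WU(3) by blast
    then have "act x (e U) = act z (e U)" using e_iff[OF WU(2) xM z(1)] by simp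
    then show "x \<in> A U" using z(3) xM by (simp add: A_def)
  qed
  define \<F> where "\<F> = (INF U\<in>\<B>. principal (A U))"
  have ev: "eventually P \<F> \<longleftrightarrow> (\<exists>U\<in>\<B>. \<forall>x\<in>A U. P x)" for P
    unfolding \<F>_def
  proof (subst eventually_INF_base[OF base_nonempty])
    fix U V assume UV: "U \<in> \<B>" "V \<in> \<B>"
    then obtain W where "W \<in> \<B>" "W \<subseteq> U" "W \<subseteq> V" using base_directed[of "{U, V}"] by auto
    then show "\<exists>W\<in>\<B>. principal (A W) \<le> inf (principal (A U)) (principal (A V))"
      using A_mono UV by (intro bexI[of _ W]) (simp_all add: inf_principal)
  qed (simp add: eventually_principal)
  have "\<F> \<noteq> bot"
    using ev[of "\<lambda>_. False"] A_ne unfolding trivial_limit_def by blast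
  moreover have "\<F> \<le> principal (carrier M)"
    using base_nonempty unfolding le_principal ev by (auto simp: A_def)
  moreover have "\<exists>B. (\<forall>\<^sub>F x in \<F>. x \<in> B) \<and> B \<times> B \<subseteq> U" if U: "U \<in> \<U>" for U
  proof -
    obtain W where W: "W \<in> \<B>" "W \<subseteq> U" using U base unfolding uniformity_base_def by meson
    have "\<forall>\<^sub>F x in \<F>. x \<in> A W" unfolding ev using W(1) by blast
    moreover have "A W \<times> A W \<subseteq> U" using A_small[OF W(1)] W(2) by (rule order_trans)
    ultimately show ?thesis by blast
  qed
  ultimately obtain x where x: "x \<in> carrier M" "\<And>U. U \<in> \<U> \<Longrightarrow> \<forall>\<^sub>F y in \<F>. (x, y) \<in> U"
    using complete unfolding complete_uniformity_def by meson
  have x_e: "act x (e U) = f (e U)" if U: "U \<in> \<B>" for U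
  proof -
    have "\<forall>\<^sub>F y in \<F>. (x, y) \<in> U" using x(2) U base by (auto simp: uniformity_base_def)
    moreover have "\<forall>\<^sub>F y in \<F>. y \<in> A U" unfolding ev using U by blast
    ultimately have "\<forall>\<^sub>F y in \<F>. (x, y) \<in> U \<and> y \<in> A U" by (rule eventually_conj)
    from eventually_happens'[OF \<open>\<F> \<noteq> bot\<close> this] obtain y where "(x, y) \<in> U" "y \<in> A U" by blast
    then show ?thesis using e_iff[OF U x(1), of y] by (simp add: A_def)
  qed
  have "act x p = f p" if p: "p \<in> points" for p
  proof -
    obtain W where W: "W \<in> \<B>" "\<forall>y. (x, y) \<in> W \<longrightarrow> act y p = act x p"
      using act_locally_constant[of "{p}" x] x(1) p by auto
    obtain y where y: "y \<in> carrier M" "act y (e W) = f (e W)" "act y p = f p"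
      using ap[of "{e W, p}"] e[OF W(1)] p by auto
    have "act x (e W) = act y (e W)" using x_e[OF W(1)] y(2) by simp
    then have "(x, y) \<in> W" using e_iff[OF W(1) x(1) y(1)] by simp
    then show ?thesis using W(2) y(3) by metis
  qed
  with x(1) show ?thesis by blast
qed

lemma closed_representation_act: "closed_representation M T points act"
proof
  show closed: "act x \<in> points \<rightarrow>\<^sub>E points" if x: "x \<in> carrier M" for x
  proof (rule PiE_I)
    fix p assume "p \<in> points"
    then show "act x p \<in> points"
      using x by (auto elim!: pointsE simp: act_class class_in_points)
  next
    fix p assume "p \<notin> points"
    then show "act x p = undefined" by (simp add: act_def)
  qed
  show "act (x \<otimes> y) p = act x (act y p)" if "x \<in> carrier M" "y \<in> carrier M" "p \<in> points" for x y p
    using that by (auto elim!: pointsE simp: act_class m_assoc)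
  show "act \<one> p = p" if "p \<in> points" for p
    using that by (auto elim!: pointsE simp: act_class)
  show "inj_on act (carrier M)"
  proof (rule inj_onI, rule ccontr)
    fix x y assume xy: "x \<in> carrier M" "y \<in> carrier M" "act x = act y" "x \<noteq> y"
    then obtain V W where V: "openin T V" "openin T W" "x \<in> V" "y \<in> W" "disjnt V W"
      using Hausdorff unfolding Hausdorff_space_def topspace_carrier by meson
    then obtain U where U: "U \<in> \<B>" "{z. (x, z) \<in> U} \<subseteq> V" unfolding openin_iff_base[of V] by blast
    have "(x, y) \<in> U" using act_one_eq_iff[OF U(1) xy(1,2)] xy(3) by simp
    then have "y \<in> V" using U(2) by blast
    then show False using V(4,5) by (auto simp: disjnt_iff)
  qed
  show "openin T W \<longleftrightarrow> W \<subseteq> carrier M \<and> (\<forall>x\<in>W. \<exists>F. finite F \<and> F \<subseteq> points \<and>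
      (\<forall>y\<in>carrier M. (\<forall>p\<in>F. act y p = act x p) \<longrightarrow> y \<in> W))" for W
  proof -
    have eq: "(\<exists>U\<in>\<B>. {y. (x, y) \<in> U} \<subseteq> W) \<longleftrightarrow> (\<exists>F. finite F \<and> F \<subseteq> points \<and>
      (\<forall>y\<in>carrier M. (\<forall>p\<in>F. act y p = act x p) \<longrightarrow> y \<in> W))" (is "?L \<longleftrightarrow> ?R")
      if x: "x \<in> carrier M" for x
    proof
      assume ?L
      then obtain U where U: "U \<in> \<B>" "{y. (x, y) \<in> U} \<subseteq> W" by blast
      have "y \<in> W" if "y \<in> carrier M" "\<forall>p\<in>{((U, U `` {\<one>}), 0)}. act y p = act x p" for y
        using act_one_eq_iff[OF U(1) x that(1), of 0] that(2) U(2) by auto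
      moreover have "{((U, U `` {\<one>}), 0)} \<subseteq> points" using class_in_points[OF U(1) one_closed] by simp
      ultimately show ?R by (intro exI[of _ "{((U, U `` {\<one>}), 0)}"]) simp
    next
      assume ?R
      then obtain F where F0: "finite F \<and> F \<subseteq> points \<and>
        (\<forall>y\<in>carrier M. (\<forall>p\<in>F. act y p = act x p) \<longrightarrow> y \<in> W)" ..
      then obtain U where U: "U \<in> \<B>" "\<forall>y. (x, y) \<in> U \<longrightarrow> (\<forall>p\<in>F. act y p = act x p)"
        using act_locally_constant[of F x] x by blast
      have "{y. (x, y) \<in> U} \<subseteq> carrier M" using base_equiv[OF U(1)] by (auto simp: equiv_def)
      then have "{y. (x, y) \<in> U} \<subseteq> W" using F0 U(2) by (auto simp: subset_iff)
      with U(1) show ?L by blast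
    qed
    show ?thesis
      unfolding openin_iff_base[of W]
      by (rule conj_cong[OF refl], rule ball_cong[OF refl], rule eq, erule (1) subsetD)
  qed
  show "f \<in> act ` carrier M" if f: "f \<in> points \<rightarrow>\<^sub>E points"
    and ap: "\<And>F. \<lbrakk>finite F; F \<subseteq> points\<rbrakk> \<Longrightarrow> \<exists>x\<in>carrier M. \<forall>p\<in>F. act x p = f p" for f
  proof -
    obtain x where x: "x \<in> carrier M" "\<forall>p\<in>points. act x p = f p"
      using approximated_map_represented[OF f ap] by blast
    have "act x = f" by (rule PiE_ext[OF closed[OF x(1)] f]) (use x(2) in blast)
    with x(1) show ?thesis by blast
  qed
qed

lemma countable_points: "countable points"
  unfolding points_def by (intro countable_SIGMA countable_base countable_classes) auto

lemma infinite_points: "infinite points"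
proof -
  obtain U where U: "U \<in> \<B>" using base_nonempty by blast
  have "range (\<lambda>k. ((U, U `` {\<one>}), k)) \<subseteq> points" using class_in_points[OF U one_closed] by blast
  moreover have "infinite (range (\<lambda>k::nat. ((U, U `` {\<one>}), k)))" by (rule range_inj_infinite) (simp add: inj_def)
  ultimately show ?thesis by (rule infinite_super)
qed

end

section \<open>Endomorphism monoids\<close>

text \<open>
  Each instance of an endomorphism condition involves only the values at the entries of one tuple, and
  at the value of an operation on it, so it passes to pointwise limits.
\<close>

lemma closedin_endomorphisms:
  assumes "is_fo_structure \<Gamma>"
  shows "closedin (pointwise_topology (universe \<Gamma>)) (endomorphisms \<Gamma>)"
  unfolding closedin_pointwise_topology
proof (intro conjI ballI impI)
  show "endomorphisms \<Gamma> \<subseteq> universe \<Gamma> \<rightarrow>\<^sub>E universe \<Gamma>" by (auto simp: endomorphisms_def)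
  fix f assume f: "f \<in> universe \<Gamma> \<rightarrow>\<^sub>E universe \<Gamma>"
    and "\<forall>F. finite F \<and> F \<subseteq> universe \<Gamma> \<longrightarrow> (\<exists>g\<in>endomorphisms \<Gamma>. \<forall>p\<in>F. g p = f p)"
  then have ap: "\<exists>g\<in>endomorphisms \<Gamma>. \<forall>p\<in>F. g p = f p" if "finite F" "F \<subseteq> universe \<Gamma>" for F
    using that by blast
  show "f \<in> endomorphisms \<Gamma>"
    unfolding endomorphisms_def
  proof (intro CollectI conjI ballI f)
    fix R xs assume R: "R \<in> rel_symbols \<Gamma>" "xs \<in> rel_interp \<Gamma> R"
    then have "set xs \<subseteq> universe \<Gamma>" using assms by (auto simp: is_fo_structure_def tuples_def)
    then obtain g where g: "g \<in> endomorphisms \<Gamma>" "\<forall>p\<in>set xs. g p = f p"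
      using ap[of "set xs"] by auto
    have eq: "map f xs = map g xs" using g(2) by simp
    show "map f xs \<in> rel_interp \<Gamma> R" using g(1) R unfolding eq by (simp add: endomorphisms_def)
  next
    fix G xs assume G: "G \<in> fun_symbols \<Gamma>" "xs \<in> tuples (universe \<Gamma>) (fun_arity \<Gamma> G)"
    then have "fun_interp \<Gamma> G xs \<in> universe \<Gamma>" "set xs \<subseteq> universe \<Gamma>"
      using assms by (auto simp: is_fo_structure_def tuples_def)
    then obtain g where g: "g \<in> endomorphisms \<Gamma>" "\<forall>p\<in>insert (fun_interp \<Gamma> G xs) (set xs). g p = f p"
      using ap[of "insert (fun_interp \<Gamma> G xs) (set xs)"] by auto
    have eq: "map f xs = map g xs" and "f (fun_interp \<Gamma> G xs) = g (fun_interp \<Gamma> G xs)"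
      using g(2) by simp_all
    then show "f (fun_interp \<Gamma> G xs) = fun_interp \<Gamma> G (map f xs)"
      using g(1) G unfolding eq by (simp add: endomorphisms_def)
  qed
qed

text \<open>
  The \<open>n\<close>-th relation symbol \<open>r n\<close> denotes the orbit under \<open>S\<close> of
  the \<open>n\<close>-tuple enumerating the first \<open>n\<close> elements.
\<close>

definition orbit_structure ::
  "(nat \<Rightarrow> 'x) \<Rightarrow> (nat \<Rightarrow> 'r) \<Rightarrow> ('x \<Rightarrow> 'x) set \<Rightarrow> ('x, 'r, 'f) fo_structure" where
  "orbit_structure e r S = \<lparr>universe = range e,
     rel_symbols = range r, rel_arity = inv_into UNIV r, rel_interp = (\<lambda>R. {map s (map e [0..<inv_into UNIV r R]) |s. s \<in> S}),
     fun_symbols = {}, fun_arity = (\<lambda>_. 0), fun_interp = (\<lambda>_ _. undefined)\<rparr>"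

lemma is_fo_structure_orbit_structure:
  assumes "S \<subseteq> range e \<rightarrow>\<^sub>E range e"
  shows "is_fo_structure (orbit_structure e r S)"
proof -
  have "s (e n) \<in> range e" if "s \<in> S" for s n
    using assms that by blast
  then show ?thesis
    by (auto simp: is_fo_structure_def orbit_structure_def tuples_def simp del: inv_into_f_f)
qed

text \<open>
  Members of \<open>S\<close> map each orbit into itself, as \<open>S\<close> is closed under
  composition. Conversely, the identity lies in \<open>S\<close>, so the tuple of the first
  \<open>n\<close> elements lies in its own orbit; an endomorphism \<open>f\<close> sends it to another
  tuple of the orbit, that is, \<open>f\<close> agrees with a member of \<open>S\<close> on these
  elements.
\<close>

lemma endomorphisms_orbit_structure:
  fixes e :: "nat \<Rightarrow> 'x" and r :: "nat \<Rightarrow> 'r"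
  assumes "inj r" and closed: "closedin (pointwise_topology (range e)) S"
    and S: "submonoid S (full_transformation_monoid (range e))"
  shows "endomorphisms (orbit_structure e r S :: ('x, 'r, 'f) fo_structure) = S"
proof
  interpret submonoid S "full_transformation_monoid (range e)" by fact
  have sub: "S \<subseteq> range e \<rightarrow>\<^sub>E range e" using closed closedin_pointwise_topology by blast
  have inv: "inv_into UNIV r (r n) = n" for n using \<open>inj r\<close> by simp
  have endo: "f \<in> endomorphisms (orbit_structure e r S :: ('x, 'r, 'f) fo_structure) \<longleftrightarrow>
    f \<in> range e \<rightarrow>\<^sub>E range e \<and>
    (\<forall>n. \<forall>s\<in>S. \<exists>t\<in>S. map f (map s (map e [0..<n])) = map t (map e [0..<n]))" for f
    by (auto simp: endomorphisms_def orbit_structure_def inv simp del: map_map map_eq_conv) blast+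
  show "S \<subseteq> endomorphisms (orbit_structure e r S :: ('x, 'r, 'f) fo_structure)"
  proof
    fix f assume f: "f \<in> S"
    have "\<exists>t\<in>S. map f (map s (map e [0..<n])) = map t (map e [0..<n])" if s: "s \<in> S" for s n
    proof (rule bexI)
      show "compose (range e) f s \<in> S" using m_closed[OF f s] by (simp add: full_transformation_monoid_def)
      show "map f (map s (map e [0..<n])) = map (compose (range e) f s) (map e [0..<n])"
        by (simp add: compose_def)
    qed
    then show "f \<in> endomorphisms (orbit_structure e r S :: ('x, 'r, 'f) fo_structure)"
      unfolding endo using f sub by blast
  qed
  show "endomorphisms (orbit_structure e r S :: ('x, 'r, 'f) fo_structure) \<subseteq> S"
  proof
    fix f assume "f \<in> endomorphisms (orbit_structure e r S :: ('x, 'r, 'f) fo_structure)"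
    then have f: "f \<in> range e \<rightarrow>\<^sub>E range e"
      "\<And>n s. s \<in> S \<Longrightarrow> \<exists>t\<in>S. map f (map s (map e [0..<n])) = map t (map e [0..<n])"
      unfolding endo by blast+
    have "\<exists>t\<in>S. \<forall>p\<in>F. t p = f p" if F: "finite F" "F \<subseteq> range e" for F
    proof -
      obtain N where N: "finite N" "F = e ` N" using finite_subset_image[OF F] by blast
      obtain n where n: "\<And>k. k \<in> N \<Longrightarrow> k < n" using N(1) unfolding finite_nat_set_iff_bounded by blast
      have one: "(\<lambda>p\<in>range e. p) \<in> S" using one_closed by (simp add: full_transformation_monoid_def)
      obtain t where t: "t \<in> S" "map f (map (\<lambda>p\<in>range e. p) (map e [0..<n])) = map t (map e [0..<n])"
        using f(2)[OF one, of n] by (elim bexE)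
      have "f (e k) = t (e k)" if "k < n" for k using t(2) that by simp
      then show ?thesis using t(1) n N(2) by (intro bexI[of _ t]) auto
    qed
    then show "f \<in> S" using closed f(1) unfolding closedin_pointwise_topology by blast
  qed
qed

section \<open>The four descriptions coincide\<close>

lemma all_equivalent_cycle:
  assumes "A \<Longrightarrow> C" "C \<Longrightarrow> D" "D \<Longrightarrow> B" "B \<Longrightarrow> A"
  shows "all_equivalent [A, B, C, D]"
  unfolding all_equivalent_def using assms by auto

theorem theorem2:
  fixes M :: "('a, 'm) monoid_scheme" and T :: "'a topology"
  assumes "topological_monoid M T"
  shows "all_equivalent
    [\<exists>\<Gamma> :: ('x::infinite, 'r::infinite, 'f) fo_structure.
       is_fo_structure \<Gamma> \<and> countable (universe \<Gamma>) \<and>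
       topologically_isomorphic M T (End_monoid \<Gamma>) (End_topology \<Gamma>),

     \<exists>S. submonoid S (full_transformation_monoid {1::nat..}) \<and>
       closedin (pointwise_topology {1::nat..}) S \<and>
       topologically_isomorphic M T
         (full_transformation_monoid {1::nat..} \<lparr>carrier := S\<rparr>)
         (subtopology (pointwise_topology {1::nat..}) S),

     separable_space T \<and>
       (\<exists>d. ultrametric_on (carrier M) d \<and>
            Metric_space.mtopology (carrier M) d = T \<and>
            Metric_space.mcomplete (carrier M) d \<and>
            left_non_expansive M d),

     Hausdorff_space T \<and>
       (\<exists>\<U> \<B>. uniformity_on_set (carrier M) \<U> \<and>
              compatible_uniformity T \<U> \<and>
              complete_uniformity (carrier M) \<U> \<and>
              uniformity_base \<U> \<B> \<and> countable \<B> \<and>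
              (\<forall>U\<in>\<B>. equiv (carrier M) U \<and> countable (carrier M // U)) \<and>
              (\<forall>U\<in>\<B>. \<forall>x\<in>carrier M. \<forall>y\<in>carrier M. \<forall>z\<in>carrier M.
                 (y, z) \<in> U \<longrightarrow> (x \<otimes>\<^bsub>M\<^esub> y, x \<otimes>\<^bsub>M\<^esub> z) \<in> U))]"
proof -
  have M: "monoid M" and top: "topspace T = carrier M"
    using assms by (simp_all add: topological_monoid_def)
  let ?P1 = "\<exists>\<Gamma> :: ('x, 'r, 'f) fo_structure.
       is_fo_structure \<Gamma> \<and> countable (universe \<Gamma>) \<and>
       topologically_isomorphic M T (End_monoid \<Gamma>) (End_topology \<Gamma>)"
  let ?P2 = "\<exists>S. submonoid S (full_transformation_monoid {1::nat..}) \<and>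
       closedin (pointwise_topology {1::nat..}) S \<and>
       topologically_isomorphic M T
         (full_transformation_monoid {1::nat..} \<lparr>carrier := S\<rparr>)
         (subtopology (pointwise_topology {1::nat..}) S)"
  let ?P3 = "separable_space T \<and>
       (\<exists>d. ultrametric_on (carrier M) d \<and>
            Metric_space.mtopology (carrier M) d = T \<and>
            Metric_space.mcomplete (carrier M) d \<and>
            left_non_expansive M d)"
  let ?P4 = "Hausdorff_space T \<and>
       (\<exists>\<U> \<B>. uniformity_on_set (carrier M) \<U> \<and>
              compatible_uniformity T \<U> \<and>
              complete_uniformity (carrier M) \<U> \<and>
              uniformity_base \<U> \<B> \<and> countable \<B> \<and>
              (\<forall>U\<in>\<B>. equiv (carrier M) U \<and> countable (carrier M // U)) \<and>
              (\<forall>U\<in>\<B>. \<forall>x\<in>carrier M. \<forall>y\<in>carrier M. \<forall>z\<in>carrier M.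
                 (y, z) \<in> U \<longrightarrow> (x \<otimes>\<^bsub>M\<^esub> y, x \<otimes>\<^bsub>M\<^esub> z) \<in> U))"
  have P13: ?P3 if P: ?P1
  proof -
    obtain \<Gamma> :: "('x, 'r, 'f) fo_structure" where \<Gamma>: "is_fo_structure \<Gamma>" "countable (universe \<Gamma>)"
      "topologically_isomorphic M T (End_monoid \<Gamma>) (End_topology \<Gamma>)" using P by blast
    obtain \<rho> where "closed_representation M T (universe \<Gamma>) \<rho>"
      using closed_representation_of_isomorphic[OF M top closedin_endomorphisms[OF \<Gamma>(1)]] \<Gamma>(3)
      unfolding End_monoid_def End_topology_def by blast
    then interpret countable_closed_representation M T "universe \<Gamma>" \<rho>
      by (simp add: countable_closed_representation_def countable_closed_representation_axioms_def \<Gamma>(2))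
    show ?thesis
      using separable ultrametric_difference_metric mtopology_eq mcomplete_difference_metric
        left_non_expansive_difference_metric by (intro conjI exI[of _ difference_metric])
  qed
  have P34: ?P4 if P: ?P3
  proof -
    obtain d where "ultrametric_on (carrier M) d" "Metric_space.mtopology (carrier M) d = T"
      "Metric_space.mcomplete (carrier M) d" "left_non_expansive M d" using P by blast
    then show ?thesis
      using left_invariant_uniformity_of_ultrametric[of M d T] P M by blast
  qed
  have P42: ?P2 if P: ?P4
  proof -
    obtain \<U> \<B> where U: "uniformity_on_set (carrier M) \<U>" "compatible_uniformity T \<U>"
      "complete_uniformity (carrier M) \<U>" "uniformity_base \<U> \<B>" "countable \<B>"
      "\<forall>U\<in>\<B>. equiv (carrier M) U \<and> countable (carrier M // U)"
      "\<forall>U\<in>\<B>. \<forall>x\<in>carrier M. \<forall>y\<in>carrier M. \<forall>z\<in>carrier M.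
         (y, z) \<in> U \<longrightarrow> (x \<otimes>\<^bsub>M\<^esub> y, x \<otimes>\<^bsub>M\<^esub> z) \<in> U"
      using P by (elim conjE exE)
    interpret monoid M by fact
    interpret left_invariant_uniform_monoid M T \<U> \<B>
      by unfold_locales (use U assms P in simp_all)
    obtain b :: "_ \<Rightarrow> nat" where b: "bij_betw b points UNIV"
      using countableE_infinite[OF countable_points infinite_points] .
    have "bij_betw Suc UNIV {1..}"
      by (rule bij_betwI[of _ _ _ "\<lambda>n. n - 1"]) auto
    then have "bij_betw (Suc \<circ> b) points {1..}" using b by (rule bij_betw_trans[rotated])
    then interpret R: closed_representation M T "{1::nat..}" "\<lambda>x. \<lambda>q\<in>{1..}. (Suc \<circ> b) (act x (inv_into points (Suc \<circ> b) q))"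
      by (rule closed_representation.closed_representation_conjugate[OF closed_representation_act])
    show ?thesis
      using R.submonoid_image R.closedin_image R.topologically_isomorphic_image by blast
  qed
  have P21: ?P1 if P: ?P2
  proof -
    obtain S where S: "closedin (pointwise_topology {1::nat..}) S"
      "topologically_isomorphic M T (full_transformation_monoid {1::nat..} \<lparr>carrier := S\<rparr>)
         (subtopology (pointwise_topology {1::nat..}) S)" using P by blast
    obtain \<rho> where \<rho>: "closed_representation M T {1::nat..} \<rho>"
      using closed_representation_of_isomorphic[OF M top S] by blast
    obtain e :: "nat \<Rightarrow> 'x" where e: "inj e" using infinite_UNIV infinite_countable_subset by blast
    obtain r :: "nat \<Rightarrow> 'r" where r: "inj r" using infinite_UNIV infinite_countable_subset by blast
    have "bij_betw (\<lambda>n. n - 1) {1::nat..} UNIV"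
      by (rule bij_betwI[of _ _ _ Suc]) auto
    then have "bij_betw (e \<circ> (\<lambda>n. n - 1)) {1::nat..} (range e)"
      using inj_on_imp_bij_betw[OF e] by (rule bij_betw_trans)
    from closed_representation.closed_representation_conjugate[OF \<rho> this]
    obtain \<sigma> where "closed_representation M T (range e) \<sigma>" by blast
    then interpret R: closed_representation M T "range e" \<sigma> .
    let ?\<Gamma> = "orbit_structure e r (\<sigma> ` carrier M) :: ('x, 'r, 'f) fo_structure"
    have univ: "universe ?\<Gamma> = range e" by (simp add: orbit_structure_def)
    have endo: "endomorphisms ?\<Gamma> = \<sigma> ` carrier M"
      by (rule endomorphisms_orbit_structure[OF r R.closedin_image R.submonoid_image])
    have "is_fo_structure ?\<Gamma>"
      by (rule is_fo_structure_orbit_structure) (use R.rep_closed in blast)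
    moreover have "topologically_isomorphic M T (End_monoid ?\<Gamma>) (End_topology ?\<Gamma>)"
      unfolding End_monoid_def End_topology_def univ endo by (rule R.topologically_isomorphic_image)
    moreover have "countable (universe ?\<Gamma>)" unfolding univ by simp
    ultimately show ?thesis by blast
  qed
  show ?thesis
    by (rule all_equivalent_cycle) (fact P13, fact P34, fact P42, fact P21)
qed

end
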